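(* (1) Let $n\ge 0$ be an integer and let $\partial\Delta^{n+1}$ be the boundary of an $(n+1)$-simplex. Then the space of flattenings $F(\partial\Delta^1 * \partial\Delta^{n+1})$ has the homotopy type of the orthogonal group $O(n+2)$. (2) Let $L$ be a simplicial $1$-sphere. Then the space of flattenings $F(L)$ has the homotopy type of the orthogonal group $O(2)$.
   Context: A simplicial $k$-sphere is a finite simplicial complex $L$ whose geometric realization is homeomorphic to the sphere $S^k$. $\Delta^m$ denotes an $m$-simplex, $\partial\Delta^m$ its boundary complex (a simplicial $(m-1)$-sphere; in particular $\partial\Delta^1$ consists of two points), and $*$ denotes the simplicial join, so that $\partial\Delta^1*\partial\Delta^{n+1}$ is a simplicial $(n+1)$-sphere. For a simplicial $k$-sphere $L$, let $cL$ be the simplicial cone over $L$. A flattening of $L$ is an embedding $\psi: cL\to\mathbb{R}^{k+1}$ (of the geometric realization of $cL$) that maps the cone vertex to the origin and is linear on each simplex of $cL$. $F(L)$ denotes the space of all flattenings of $L$. A flattening is determined by the images of the vertices of $L$, and $F(L)$ is topologized as a subspace (it is an open subset) of $\mathbb{R}^{(k+1)|\mathrm{Vert}(L)|}$. *)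

theory Defs
  imports "HOL-Analysis.Analysis"
begin

text \<open>
  Complexes are abstract and contain the empty simplex, so that the simplices of a join are
  exactly the disjoint unions of a simplex of each factor.
\<close>

definition finite_complex :: "'v set set \<Rightarrow> bool" where
  "finite_complex K \<longleftrightarrow>
     finite K \<and> {} \<in> K \<and> (\<forall>s\<in>K. finite s \<and> (\<forall>t. t \<subseteq> s \<longrightarrow> t \<in> K))"

definition vertices :: "'v set set \<Rightarrow> 'v set" where
  "vertices K = {v. {v} \<in> K}"

text \<open>
  A point of the realization is given by its barycentric coordinates. As only finite complexes are
  considered, the topology is that of coordinatewise convergence.
\<close>

definition geometric_simplex :: "'v set \<Rightarrow> ('v \<Rightarrow> real) set" where
  "geometric_simplex s =
     {x. (\<forall>v. 0 \<le> x v) \<and> (\<forall>v. v \<notin> s \<longrightarrow> x v = 0) \<and> (\<Sum>v\<in>s. x v) = 1}"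

definition realization :: "'v set set \<Rightarrow> ('v \<Rightarrow> real) topology" where
  "realization K = subtopology (powertop_real UNIV) (\<Union>s\<in>K. geometric_simplex s)"

definition vertex_point :: "'v \<Rightarrow> 'v \<Rightarrow> real" where
  "vertex_point v = (\<lambda>w. if w = v then 1 else 0)"

definition simplicial_sphere :: "nat \<Rightarrow> 'v set set \<Rightarrow> bool" where
  "simplicial_sphere k L \<longleftrightarrow> finite_complex L \<and> realization L homeomorphic_space nsphere k"

definition simplex_boundary :: "nat \<Rightarrow> nat set set" where
  "simplex_boundary m = {s. s \<subset> {0..m}}"

definition simplicial_join :: "'u set set \<Rightarrow> 'v set set \<Rightarrow> ('u + 'v) set set" where
  "simplicial_join K L = {s <+> t | s t. s \<in> K \<and> t \<in> L}"

text \<open>The cone vertex is \<open>Inl ()\<close>; a vertex \<open>v\<close> of \<open>L\<close> becomes \<open>Inr v\<close>.\<close>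

definition cone :: "'v set set \<Rightarrow> (unit + 'v) set set" where
  "cone L = simplicial_join {{}, {()}} L"

text \<open>
  For a simplicial \<open>k\<close>-sphere \<open>L\<close> the index type \<open>'d\<close> of the target has \<open>k + 1\<close> elements.
\<close>

definition flattening :: "'v set set \<Rightarrow> ((unit + 'v \<Rightarrow> real) \<Rightarrow> real ^ 'd) \<Rightarrow> bool" where
  "flattening L \<psi> \<longleftrightarrow>
     embedding_map (realization (cone L)) euclidean \<psi> \<and>
     \<psi> (vertex_point (Inl ())) = 0 \<and>
     (\<forall>s\<in>cone L. \<forall>x\<in>geometric_simplex s. \<psi> x = (\<Sum>v\<in>s. x v *\<^sub>R \<psi> (vertex_point v)))"

text \<open>
  A flattening is recorded by the images of the vertices of \<open>L\<close>, as a point of the product of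
  copies of \<open>real ^ 'd\<close> indexed by these vertices.
\<close>

definition vertex_images ::
    "'v set set \<Rightarrow> ((unit + 'v \<Rightarrow> real) \<Rightarrow> real ^ 'd) \<Rightarrow> ('v \<Rightarrow> real ^ 'd)" where
  "vertex_images L \<psi> = (\<lambda>v\<in>vertices L. \<psi> (vertex_point (Inr v)))"

definition flattening_space :: "'v set set \<Rightarrow> ('v \<Rightarrow> real ^ 'd) topology" where
  "flattening_space L =
     subtopology (product_topology (\<lambda>_. euclidean) (vertices L))
       (vertex_images L ` {\<psi>. flattening L \<psi>})"

definition orthogonal_group :: "(real ^ 'd ^ 'd) topology" where
  "orthogonal_group = top_of_set {A. orthogonal_matrix A}"

end

theory Submission
  imports Defs
begin

text \<open>
  A flattening is the linear extension of its values at the vertices, and the cone is compact, so a family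
  of vectors \<open>w\<close> comes from a flattening exactly if the linear extension is injective. By homogeneity this
  means that there is no nonzero linear relation between the vectors whose positive support and whose
  negative support are both simplices (\<open>fan_injective\<close>, \<open>flattening_space_eq\<close>).

  This condition is invariant under invertible linear maps, and it makes the vectors of a simplex linearly
  independent. Fix a top-dimensional simplex. Its vectors form a basis, and changing coordinates so that
  this basis becomes the standard one splits the space of flattenings into a product of the general
  linear group and the space of normalised flattenings (\<open>frame_splitting\<close>). The general linear group
  retracts to the orthogonal group by the Gram-Schmidt process. Hence both statements follow once the
  normalised flattenings form a contractible space.

  For \<open>\<partial>\<Delta>\<^sup>1 * \<partial>\<Delta>\<^sup>n\<^sup>+\<^sup>1\<close> only two vectors remain free after normalisation, and the relations
  form a plane. The condition becomes a system of linear inequalities together with inequalities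
  \<open>c * q j < p * l j\<close> between the coordinates of the two free vectors, and it defines a star-shaped set
  (\<open>suspension_sign_condition\<close>, \<open>suspension_signs_star_shaped\<close>).

  For a simplicial circle, the combinatorial type has to be found first. The link of a vertex appears as a
  level set of a barycentric coordinate. It has at most two points because a circle contains no triod, and
  at least two because removing one point does not disconnect a circle. So the complex is a
  connected graph in which all vertices have degree two, that is, a cycle (\<open>simplicial_circle_is_cycle\<close>).
  With the first edge mapped to the standard basis \<open>1, \<i>\<close> of the complex plane, the flattenings of a
  cycle are the configurations whose arguments increase by less than a half turn at each step and
  by one full turn in total (\<open>winds_once\<close>). In polar coordinates these conditions are convex.
\<close>

section \<open>Flattenings as configurations of vectors\<close>

text \<open>
  The map \<open>y \<mapsto> \<Sum> y v *\<^sub>R w v\<close> on the union of the nonnegative orthants spanned by the simplices identifies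
  two points \<open>y\<close>, \<open>y'\<close> exactly if \<open>z = y - y'\<close> is a linear relation between the vectors \<open>w v\<close>. After
  cancelling common parts, \<open>y\<close> and \<open>y'\<close> are the positive and the negative part of \<open>z\<close>, and the supports
  stay simplices because a complex is closed under passing to subsets. So the condition says that the
  cones over the simplices form a fan, with all simplices linearly independent.
\<close>

definition fan_injective :: "'v set set \<Rightarrow> ('v \<Rightarrow> 'a::real_vector) \<Rightarrow> bool" where
  "fan_injective L w \<longleftrightarrow>
     (\<forall>z::'v \<Rightarrow> real. {v. 0 < z v} \<in> L \<longrightarrow> {v. z v < 0} \<in> L \<longrightarrow>
        (\<Sum>v\<in>vertices L. z v *\<^sub>R w v) = 0 \<longrightarrow> z = (\<lambda>_. 0))"

lemma finite_complex_subset: "finite_complex K \<Longrightarrow> s \<in> K \<Longrightarrow> t \<subseteq> s \<Longrightarrow> t \<in> K"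
  by (auto simp: finite_complex_def)

lemma finite_complex_simplex: "finite_complex K \<Longrightarrow> s \<in> K \<Longrightarrow> finite s"
  by (auto simp: finite_complex_def)

lemma simplex_subset_vertices: "finite_complex K \<Longrightarrow> s \<in> K \<Longrightarrow> s \<subseteq> vertices K"
  by (auto simp: finite_complex_def vertices_def)

lemma finite_vertices: "finite_complex K \<Longrightarrow> finite (vertices K)"
proof -
  assume K: "finite_complex K"
  have "vertices K \<subseteq> \<Union>K" by (auto simp: vertices_def)
  moreover have "finite (\<Union>K)" using K by (auto simp: finite_complex_def)
  ultimately show ?thesis by (rule finite_subset)
qed

lemma topspace_realization: "topspace (realization K) = (\<Union>s\<in>K. geometric_simplex s)"
  by (simp add: realization_def)

lemma realization_top_of_set: "realization K = top_of_set (\<Union>s\<in>K. geometric_simplex s)"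
  by (simp add: realization_def euclidean_product_topology)

lemma continuous_on_coordinate: "continuous_on S (\<lambda>x::'v \<Rightarrow> real. x v)"
  by (rule continuous_on_subset[OF continuous_on_product_coordinates]) auto

lemma compact_geometric_simplex:
  assumes "finite s"
  shows "compact (geometric_simplex s)"
proof -
  have "compactin (powertop_real UNIV) (PiE UNIV (\<lambda>_::'a. {0..1::real}))"
    by (simp add: compactin_PiE)
  then have cube: "compact (PiE UNIV (\<lambda>_::'a. {0..1::real}))"
    by (simp add: euclidean_product_topology)
  have "closed {x::'a \<Rightarrow> real. \<forall>v. 0 \<le> x v}"
    by (intro closed_Collect_all closed_Collect_le continuous_intros continuous_on_coordinate)
  moreover have "closed {x::'a \<Rightarrow> real. \<forall>v. v \<notin> s \<longrightarrow> x v = 0}"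
    by (intro closed_Collect_all closed_Collect_imp closed_Collect_eq continuous_intros
        continuous_on_coordinate) auto
  moreover have "closed {x::'a \<Rightarrow> real. (\<Sum>v\<in>s. x v) = 1}"
    by (intro closed_Collect_eq continuous_intros continuous_on_coordinate)
  ultimately have "closed (geometric_simplex s)"
    unfolding geometric_simplex_def by (intro closed_Collect_conj)
  moreover have "geometric_simplex s \<subseteq> PiE UNIV (\<lambda>_. {0..1})"
  proof
    fix x assume x: "x \<in> geometric_simplex s"
    have "x v \<le> 1" for v
    proof (cases "v \<in> s")
      case True
      then have "x v \<le> (\<Sum>v\<in>s. x v)"
        using x assms by (intro member_le_sum) (auto simp: geometric_simplex_def)
      then show ?thesis using x by (simp add: geometric_simplex_def)
    qed (use x in \<open>auto simp: geometric_simplex_def\<close>)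
    then show "x \<in> PiE UNIV (\<lambda>_. {0..1})"
      using x by (auto simp: geometric_simplex_def)
  qed
  ultimately show ?thesis
    using cube by (metis closed_Int_compact inf.absorb1)
qed

lemma compact_space_realization: "finite_complex K \<Longrightarrow> compact_space (realization K)"
  unfolding realization_top_of_set compact_space_subtopology
  by (auto simp: finite_complex_def compact_space_def intro!: compact_UN compact_geometric_simplex)

lemma finite_complex_cone:
  assumes "finite_complex L"
  shows "finite_complex (cone L)"
proof -
  have "t \<in> cone L" if st: "s \<in> cone L" "t \<subseteq> s" for s t
  proof -
    obtain a b where s: "s = a <+> b" "a \<in> {{}, {()}}" "b \<in> L"
      using st(1) unfolding cone_def simplicial_join_def by blast
    have "v \<in> t \<longleftrightarrow> v \<in> Inl -` t <+> Inr -` t" for v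
      by (cases v) auto
    then have "t = Inl -` t <+> Inr -` t" by blast
    moreover have "Inl -` t \<in> {{}, {()}}" by auto
    moreover have "Inr -` t \<in> L"
      by (rule finite_complex_subset[OF assms s(3)]) (use st s in auto)
    ultimately show ?thesis unfolding cone_def simplicial_join_def by blast
  qed
  moreover have sub: "cone L \<subseteq> (\<lambda>t. {} <+> t) ` L \<union> (\<lambda>t. {()} <+> t) ` L"
    unfolding cone_def simplicial_join_def by blast
  have "finite (cone L)"
    by (rule finite_subset[OF sub]) (use assms in \<open>simp add: finite_complex_def\<close>)
  moreover have "finite s" if "s \<in> cone L" for s
    using subsetD[OF sub that] assms by (auto simp: finite_complex_def)
  moreover have "{} \<in> cone L"
    using assms unfolding cone_def simplicial_join_def finite_complex_def
    by (auto intro!: exI[of _ "{}"])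
  ultimately show ?thesis unfolding finite_complex_def by blast
qed

text \<open>
  Barycentric coordinates on the cone are determined by those at the vertices of \<open>L\<close>: the cone vertex
  receives whatever is missing to total weight \<open>1\<close>.
\<close>

definition cone_point :: "'v set set \<Rightarrow> ('v \<Rightarrow> real) \<Rightarrow> (unit + 'v \<Rightarrow> real)" where
  "cone_point L f = case_sum (\<lambda>_. 1 - (\<Sum>v\<in>vertices L. f v)) f"

lemma cone_point_in_cone:
  assumes L: "finite_complex L" and f: "\<And>v. 0 \<le> f v" "{v. 0 < f v} \<in> L"
    "(\<Sum>v\<in>vertices L. f v) \<le> 1"
  shows "{()} <+> {v. 0 < f v} \<in> cone L"
    and "cone_point L f \<in> geometric_simplex ({()} <+> {v. 0 < f v})"
proof -
  show "{()} <+> {v. 0 < f v} \<in> cone L"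
    using f by (auto simp: cone_def simplicial_join_def)
  have "(\<Sum>v\<in>vertices L. f v) = (\<Sum>v | 0 < f v. f v)"
    using finite_vertices[OF L] simplex_subset_vertices[OF L f(2)] f(1)
    by (intro sum.mono_neutral_right) (auto simp: less_le)
  then show "cone_point L f \<in> geometric_simplex ({()} <+> {v. 0 < f v})"
    using f finite_complex_simplex[OF L f(2)]
    by (auto simp: geometric_simplex_def cone_point_def sum.Plus less_le split: sum.splits)
qed

lemma cone_point_cases:
  assumes L: "finite_complex L" and x: "x \<in> geometric_simplex s" and s: "s \<in> cone L"
  obtains f where "x = cone_point L f" "\<And>v. 0 \<le> f v" "{v. 0 < f v} \<in> L"
    "Inr -` s \<in> L" "{v. 0 < f v} \<subseteq> Inr -` s"
proof
  let ?f = "\<lambda>v. x (Inr v)"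
  obtain a b where s': "s = a <+> b" "a \<in> {{}, {()}}" "b \<in> L"
    using s by (auto simp: cone_def simplicial_join_def)
  have b: "Inr -` s = b" using s' by auto
  then show "Inr -` s \<in> L" using s' by simp
  have pos: "\<And>v. 0 \<le> x v" and out: "\<And>v. v \<notin> s \<Longrightarrow> x v = 0" and one: "(\<Sum>v\<in>s. x v) = 1"
    using x by (auto simp: geometric_simplex_def)
  show "0 \<le> ?f v" for v using pos .
  show sub: "{v. 0 < ?f v} \<subseteq> Inr -` s" using out by force
  then show "{v. 0 < ?f v} \<in> L"
    using finite_complex_subset[OF L s'(3)] b by auto
  have "(\<Sum>v\<in>b. ?f v) = (\<Sum>v\<in>vertices L. ?f v)"
    using finite_vertices[OF L] simplex_subset_vertices[OF L s'(3)] b out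
    by (intro sum.mono_neutral_left) auto
  moreover have "(\<Sum>v\<in>s. x v) = (\<Sum>u\<in>a. x (Inl u)) + (\<Sum>v\<in>b. ?f v)"
    using s' finite_complex_simplex[OF L s'(3)] by (auto simp: sum.Plus)
  moreover have "(\<Sum>u\<in>a. x (Inl u)) = x (Inl ())"
    using s'(2) out[of "Inl ()"] s'(1) by (auto simp: Plus_def)
  ultimately have "x (Inl ()) = 1 - (\<Sum>v\<in>vertices L. ?f v)"
    using one by simp
  then show "x = cone_point L ?f"
    by (auto simp: cone_point_def fun_eq_iff split: sum.splits)
qed

lemma flattening_cone_point:
  assumes L: "finite_complex L" and \<psi>: "flattening L \<psi>"
    and f: "\<And>v. 0 \<le> f v" "{v. 0 < f v} \<in> L" "(\<Sum>v\<in>vertices L. f v) \<le> 1"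
  shows "\<psi> (cone_point L f) = (\<Sum>v\<in>vertices L. f v *\<^sub>R vertex_images L \<psi> v)"
proof -
  let ?s = "{()} <+> {v. 0 < f v}"
  have "\<psi> (cone_point L f) = (\<Sum>v\<in>?s. cone_point L f v *\<^sub>R \<psi> (vertex_point v))"
    using \<psi> cone_point_in_cone[OF L f] unfolding flattening_def by blast
  also have "\<dots> = (\<Sum>v | 0 < f v. f v *\<^sub>R \<psi> (vertex_point (Inr v)))"
    using \<psi> finite_complex_simplex[OF L f(2)]
    by (simp add: sum.Plus cone_point_def flattening_def)
  also have "\<dots> = (\<Sum>v\<in>vertices L. f v *\<^sub>R \<psi> (vertex_point (Inr v)))"
    using finite_vertices[OF L] simplex_subset_vertices[OF L f(2)] f(1)
    by (intro sum.mono_neutral_left) (auto simp: less_le)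
  finally show ?thesis by (simp add: vertex_images_def)
qed

text \<open>
  A forbidden relation, scaled down until its positive and negative part have total weight at most
  \<open>1\<close>, yields two points of the cone with the same image.
\<close>

lemma flattening_imp_fan_injective:
  fixes \<psi> :: "(unit + 'v \<Rightarrow> real) \<Rightarrow> real ^ 'd"
  assumes L: "finite_complex L" and \<psi>: "flattening L \<psi>"
  shows "fan_injective L (vertex_images L \<psi>)"
  unfolding fan_injective_def
proof (intro allI impI)
  fix z :: "'v \<Rightarrow> real"
  let ?V = "vertices L" and ?w = "vertex_images L \<psi>"
  assume P: "{v. 0 < z v} \<in> L" and N: "{v. z v < 0} \<in> L" and rel: "(\<Sum>v\<in>?V. z v *\<^sub>R ?w v) = 0"
  define N0 where "N0 = 1 + (\<Sum>v\<in>?V. \<bar>z v\<bar>)"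
  have N0: "0 < N0" unfolding N0_def by (smt (verit) sum_nonneg abs_ge_zero)
  define f g where "f = (\<lambda>v. max (z v) 0 / N0)" and "g = (\<lambda>v. max (- z v) 0 / N0)"
  have le: "(\<Sum>v\<in>?V. max (y v) 0 / N0) \<le> 1" if "\<And>v. \<bar>y v\<bar> = \<bar>z v\<bar>" for y
  proof -
    have "(\<Sum>v\<in>?V. max (y v) 0) \<le> (\<Sum>v\<in>?V. \<bar>z v\<bar>)"
      using that by (intro sum_mono) (simp flip: that)
    then show ?thesis using N0 by (simp add: N0_def flip: sum_divide_distrib)
  qed
  have f: "\<And>v. 0 \<le> f v" "{v. 0 < f v} \<in> L" "(\<Sum>v\<in>?V. f v) \<le> 1"
    using N0 P le[of z] by (auto simp: f_def zero_less_divide_iff less_max_iff_disj)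
  have g: "\<And>v. 0 \<le> g v" "{v. 0 < g v} \<in> L" "(\<Sum>v\<in>?V. g v) \<le> 1"
    using N0 N le[of "\<lambda>v. - z v"] by (auto simp: g_def zero_less_divide_iff less_max_iff_disj)
  have diff: "f v - g v = z v / N0" for v
    by (auto simp: f_def g_def max_def)
  have "(\<Sum>v\<in>?V. f v *\<^sub>R ?w v) - (\<Sum>v\<in>?V. g v *\<^sub>R ?w v) = (1 / N0) *\<^sub>R (\<Sum>v\<in>?V. z v *\<^sub>R ?w v)"
    by (simp add: diff scaleR_sum_right flip: sum_subtractf scaleR_diff_left)
  also have "\<dots> = 0" by (simp add: rel)
  finally have "\<psi> (cone_point L f) = \<psi> (cone_point L g)"
    using flattening_cone_point[OF L \<psi> f] flattening_cone_point[OF L \<psi> g] by simp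
  moreover have "cone_point L f \<in> topspace (realization (cone L))"
    "cone_point L g \<in> topspace (realization (cone L))"
    using cone_point_in_cone[OF L f] cone_point_in_cone[OF L g]
    by (auto simp: topspace_realization)
  moreover have "inj_on \<psi> (topspace (realization (cone L)))"
    using \<psi> embedding_imp_closed_map_eq by (auto simp: flattening_def embedding_map_def homeomorphic_map_def)
  ultimately have "cone_point L f = cone_point L g" by (simp add: inj_on_eq_iff)
  then have "f v = g v" for v
    by (metis cone_point_def sum.case(2))
  then show "z = (\<lambda>_. 0)" using diff N0 by (simp add: fun_eq_iff)
qed

text \<open>
  The linear extension of \<open>w\<close> to the cone is continuous and injective; as the cone is compact, it is an
  embedding.
\<close>

lemma fan_injective_imp_flattening:
  fixes w :: "'v \<Rightarrow> real ^ 'd"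
  assumes L: "finite_complex L" and w: "w \<in> vertices L \<rightarrow>\<^sub>E UNIV" and inj: "fan_injective L w"
  obtains \<psi> where "flattening L \<psi>" "vertex_images L \<psi> = w"
proof
  let ?V = "vertices L"
  define \<psi> where "\<psi> = (\<lambda>x::unit + 'v \<Rightarrow> real. \<Sum>v\<in>?V. x (Inr v) *\<^sub>R w v)"
  have inj_on: "inj_on \<psi> (topspace (realization (cone L)))"
  proof (rule inj_onI)
    fix x y assume "x \<in> topspace (realization (cone L))" "y \<in> topspace (realization (cone L))"
      and eq: "\<psi> x = \<psi> y"
    then obtain s t where s: "s \<in> cone L" "x \<in> geometric_simplex s"
      and t: "t \<in> cone L" "y \<in> geometric_simplex t"
      by (auto simp: topspace_realization)
    obtain f where f: "x = cone_point L f" "\<And>v. 0 \<le> f v" "{v. 0 < f v} \<in> L"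
      using cone_point_cases[OF L s(2,1)] by metis
    obtain g where g: "y = cone_point L g" "\<And>v. 0 \<le> g v" "{v. 0 < g v} \<in> L"
      using cone_point_cases[OF L t(2,1)] by metis
    have "{v. 0 < f v - g v} \<in> L" "{v. f v - g v < 0} \<in> L"
      by (rule finite_complex_subset[OF L f(3)], use g(2) in \<open>auto intro: le_less_trans\<close>)
         (rule finite_complex_subset[OF L g(3)], use f(2) in \<open>auto intro: le_less_trans\<close>)
    moreover have "(\<Sum>v\<in>?V. (f v - g v) *\<^sub>R w v) = 0"
      using eq by (simp add: \<psi>_def f(1) g(1) cone_point_def scaleR_diff_left sum_subtractf)
    ultimately have "(\<lambda>v. f v - g v) = (\<lambda>_. 0)"
      using inj unfolding fan_injective_def by (elim allE[of _ "\<lambda>v. f v - g v"]) simp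
    then have "f = g" by (simp add: fun_eq_iff)
    then show "x = y" using f g by simp
  qed
  have cont: "continuous_map (realization (cone L)) euclidean \<psi>"
    unfolding realization_top_of_set \<psi>_def continuous_map_iff_continuous
    by (intro continuous_intros continuous_on_coordinate)
  have vp: "\<psi> (vertex_point (Inr v)) = w v" if "v \<in> ?V" for v
    using that finite_vertices[OF L]
    by (simp add: \<psi>_def vertex_point_def if_distrib[of "\<lambda>c. c *\<^sub>R _"] cong: if_cong)
  have lin: "\<psi> x = (\<Sum>v\<in>s. x v *\<^sub>R \<psi> (vertex_point v))"
    if s: "s \<in> cone L" and x: "x \<in> geometric_simplex s" for s x
  proof -
    obtain f where f: "x = cone_point L f" "\<And>v. 0 \<le> f v" "Inr -` s \<in> L" "{v. 0 < f v} \<subseteq> Inr -` s"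
      using cone_point_cases[OF L x s] by metis
    have 0: "\<psi> (vertex_point v) = 0" if "v \<in> s - Inr ` (Inr -` s)" for v
      using that by (cases v) (auto simp: \<psi>_def vertex_point_def)
    have "(\<Sum>v\<in>s. x v *\<^sub>R \<psi> (vertex_point v)) = (\<Sum>v\<in>Inr ` (Inr -` s). x v *\<^sub>R \<psi> (vertex_point v))"
      using finite_complex_simplex[OF finite_complex_cone[OF L] s] 0
      by (intro sum.mono_neutral_right) auto
    also have "\<dots> = (\<Sum>v\<in>Inr -` s. f v *\<^sub>R \<psi> (vertex_point (Inr v)))"
      by (subst sum.reindex) (auto simp: f(1) cone_point_def)
    also have "\<dots> = (\<Sum>v\<in>Inr -` s. f v *\<^sub>R w v)"
      using simplex_subset_vertices[OF L f(3)] by (intro sum.cong) (auto simp: vp)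
    also have "\<dots> = (\<Sum>v\<in>?V. f v *\<^sub>R w v)"
      using simplex_subset_vertices[OF L f(3)] finite_vertices[OF L] f(2,4)
      by (intro sum.mono_neutral_left) (auto simp: less_le)
    finally show ?thesis by (simp add: \<psi>_def f(1) cone_point_def)
  qed
  show "flattening L \<psi>"
    unfolding flattening_def
  proof (intro conjI ballI)
    show "embedding_map (realization (cone L)) euclidean \<psi>"
      by (rule continuous_imp_embedding_map[OF cont])
         (use inj_on compact_space_realization[OF finite_complex_cone[OF L]] in auto)
    show "\<psi> (vertex_point (Inl ())) = 0"
      by (simp add: \<psi>_def vertex_point_def)
  qed (rule lin)
  show "vertex_images L \<psi> = w"
    using w vp by (auto simp: vertex_images_def fun_eq_iff PiE_def extensional_def)
qed

lemma flattening_space_eq: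
  assumes "finite_complex L"
  shows "(flattening_space L :: ('v \<Rightarrow> real ^ 'd) topology) =
    subtopology (product_topology (\<lambda>_. euclidean) (vertices L))
      {w \<in> vertices L \<rightarrow>\<^sub>E UNIV. fan_injective L w}"
proof -
  have "vertex_images L ` {\<psi>. flattening L \<psi>} =
     {w \<in> vertices L \<rightarrow>\<^sub>E (UNIV :: (real ^ 'd) set). fan_injective L w}"
  proof (intro set_eqI iffI)
    fix w :: "'v \<Rightarrow> real ^ 'd"
    assume "w \<in> vertex_images L ` {\<psi>. flattening L \<psi>}"
    then show "w \<in> {w \<in> vertices L \<rightarrow>\<^sub>E UNIV. fan_injective L w}"
      using flattening_imp_fan_injective[OF assms] by (auto simp: vertex_images_def)
  next
    fix w :: "'v \<Rightarrow> real ^ 'd"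
    assume "w \<in> {w \<in> vertices L \<rightarrow>\<^sub>E UNIV. fan_injective L w}"
    then show "w \<in> vertex_images L ` {\<psi>. flattening L \<psi>}"
      using fan_injective_imp_flattening[OF assms, of w] by (smt (verit) imageI mem_Collect_eq)
  qed
  then show ?thesis by (simp add: flattening_space_def)
qed

section \<open>Orthonormalisation of invertible matrices\<close>

abbreviation GL :: "(real ^ 'd ^ 'd) set" where
  "GL \<equiv> {A. invertible A}"

fun gram_schmidt :: "(nat \<Rightarrow> 'a::real_inner) \<Rightarrow> nat \<Rightarrow> 'a" where
  "gram_schmidt v k = sgn (v k - (\<Sum>j<k. (v k \<bullet> gram_schmidt v j) *\<^sub>R gram_schmidt v j))"

declare gram_schmidt.simps [simp del]

lemma gram_schmidt_in_span: "gram_schmidt v k \<in> span (v ` {..k})"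
proof (induction k rule: less_induct)
  case (less k)
  have "gram_schmidt v j \<in> span (v ` {..k})" if "j < k" for j
    by (rule subsetD[OF span_mono less[OF that]]) (use that in auto)
  then show ?case
    by (subst gram_schmidt.simps)
       (auto simp: sgn_div_norm intro!: span_mul span_diff span_sum intro: span_base)
qed

text \<open>
  The vector that is normalised in the recursion does not vanish; this is where independence enters,
  and it is also what makes the construction continuous.
\<close>

lemma gram_schmidt_residue:
  assumes "v k \<notin> span (v ` {..<k})"
  shows "v k - (\<Sum>j<k. (v k \<bullet> gram_schmidt v j) *\<^sub>R gram_schmidt v j) \<noteq> 0"
proof
  assume "v k - (\<Sum>j<k. (v k \<bullet> gram_schmidt v j) *\<^sub>R gram_schmidt v j) = 0"
  then have "v k = (\<Sum>j<k. (v k \<bullet> gram_schmidt v j) *\<^sub>R gram_schmidt v j)" by simp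
  also have "\<dots> \<in> span (v ` {..<k})"
  proof (intro span_sum span_mul)
    fix j assume "j \<in> {..<k}"
    then show "gram_schmidt v j \<in> span (v ` {..<k})"
      by (intro subsetD[OF span_mono gram_schmidt_in_span]) auto
  qed
  finally show False using assms by simp
qed

text \<open>
  The triangular form of the construction: the \<open>k\<close>-th vector is a positive multiple of its
  orthonormalisation plus a combination of earlier ones. Positivity of the diagonal survives convex
  combinations, which is why straight lines stay inside the invertible matrices.
\<close>

lemma gram_schmidt_decomposition:
  assumes "v k \<notin> span (v ` {..<k})"
  obtains c where "0 < c"
    "v k = c *\<^sub>R gram_schmidt v k + (\<Sum>j<k. (v k \<bullet> gram_schmidt v j) *\<^sub>R gram_schmidt v j)"
proof
  let ?u = "v k - (\<Sum>j<k. (v k \<bullet> gram_schmidt v j) *\<^sub>R gram_schmidt v j)"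
  have u: "?u \<noteq> 0" using gram_schmidt_residue[OF assms] .
  then show "0 < norm ?u" by simp
  have "norm ?u *\<^sub>R gram_schmidt v k = ?u"
    using u by (subst (3) gram_schmidt.simps) (simp add: sgn_div_norm)
  then show "v k = norm ?u *\<^sub>R gram_schmidt v k +
      (\<Sum>j<k. (v k \<bullet> gram_schmidt v j) *\<^sub>R gram_schmidt v j)"
    by simp
qed

lemma gram_schmidt_orthonormal:
  assumes v: "\<And>k. k < n \<Longrightarrow> v k \<notin> span (v ` {..<k})"
  shows "k < n \<Longrightarrow> norm (gram_schmidt v k) = 1"
    and "i < k \<Longrightarrow> k < n \<Longrightarrow> gram_schmidt v k \<bullet> gram_schmidt v i = 0"
proof -
  let ?g = "gram_schmidt v"
  show norm: "norm (?g k) = 1" if "k < n" for k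
    using gram_schmidt_residue[of v k] v[OF that] by (subst gram_schmidt.simps) (simp add: norm_sgn)
  show "?g k \<bullet> ?g i = 0" if "i < k" "k < n"
    using that
  proof (induction k arbitrary: i rule: less_induct)
    case (less k)
    have orth: "?g j \<bullet> ?g i = (if j = i then 1 else 0)" if "j < k" for j
      using that less.IH[of j i] less.IH[of i j] less.prems norm[of i]
      by (cases i j rule: linorder_cases) (auto simp: inner_commute norm_eq_1)
    obtain c where c: "0 < c" "v k = c *\<^sub>R ?g k + (\<Sum>j<k. (v k \<bullet> ?g j) *\<^sub>R ?g j)"
      using gram_schmidt_decomposition[of v k] v[of k] less.prems(2) by auto
    have "v k \<bullet> ?g i = c * (?g k \<bullet> ?g i) + (\<Sum>j<k. (v k \<bullet> ?g j) * (?g j \<bullet> ?g i))"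
      by (subst (1) c(2)) (simp add: inner_add_left inner_sum_left)
    also have "(\<Sum>j<k. (v k \<bullet> ?g j) * (?g j \<bullet> ?g i)) = v k \<bullet> ?g i"
      using less.prems by (simp add: orth if_distrib[of "\<lambda>x. _ * x"] cong: if_cong)
    finally show ?case using c(1) by simp
  qed
qed

lemma gram_schmidt_of_orthonormal:
  assumes "\<And>k. k < n \<Longrightarrow> norm (v k) = 1"
    and "\<And>i k. i < k \<Longrightarrow> k < n \<Longrightarrow> v k \<bullet> v i = 0"
  shows "k < n \<Longrightarrow> gram_schmidt v k = v k"
proof (induction k rule: less_induct)
  case (less k)
  then have "(\<Sum>j<k. (v k \<bullet> gram_schmidt v j) *\<^sub>R gram_schmidt v j) = 0"
    using assms(2) by (intro sum.neutral) auto
  then show ?case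
    using assms(1)[OF less.prems] by (subst gram_schmidt.simps) (simp add: sgn_div_norm)
qed

lemma continuous_on_gram_schmidt:
  assumes "\<And>j. j < n \<Longrightarrow> continuous_on S (\<lambda>x. v x j)"
    and "\<And>x j. x \<in> S \<Longrightarrow> j < n \<Longrightarrow> v x j \<notin> span (v x ` {..<j})"
  shows "k < n \<Longrightarrow> continuous_on S (\<lambda>x. gram_schmidt (v x) k)"
proof (induction k rule: less_induct)
  case (less k)
  have "continuous_on S (\<lambda>x. sgn (v x k -
      (\<Sum>j<k. (v x k \<bullet> gram_schmidt (v x) j) *\<^sub>R gram_schmidt (v x) j)))"
    using less assms by (intro continuous_intros ballI gram_schmidt_residue) auto
  then show ?case by (subst gram_schmidt.simps)
qed

lemma invertible_iff_kernel:
  fixes A :: "real ^ 'd ^ 'd"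
  shows "invertible A \<longleftrightarrow> (\<forall>x. A *v x = 0 \<longrightarrow> x = 0)"
  unfolding invertible_left_inverse matrix_left_invertible_ker ..

lemma matrix_vector_mult_component: "(A *v x) $ i = A $ i \<bullet> x" for A :: "real ^ 'd ^ 'd"
  by (simp add: matrix_vector_mult_def inner_vec_def)

text \<open>
  Pairing with the \<open>i\<close>-th vector of the dual basis separates row \<open>i\<close> from all other rows.
\<close>

lemma row_notin_span_of_rows:
  fixes A :: "real ^ 'd ^ 'd"
  assumes A: "invertible A" and "i \<notin> I"
  shows "A $ i \<notin> span ((\<lambda>j. A $ j) ` I)"
proof
  assume *: "A $ i \<in> span ((\<lambda>j. A $ j) ` I)"
  \<comment> \<open>the \<open>i\<close>-th column of the inverse is orthogonal to all rows except row \<open>i\<close>\<close>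
  obtain B where "A ** B = mat 1" using A by (auto simp: invertible_def)
  then have y: "A *v (B *v axis i 1) = axis i 1"
    by (simp add: matrix_vector_mul_assoc)
  define y where "y = B *v axis i 1"
  have Ay: "A $ j \<bullet> y = (if j = i then 1 else 0)" for j
    using y by (simp add: y_def axis_def flip: matrix_vector_mult_component)
  have "span ((\<lambda>j. A $ j) ` I) \<subseteq> {x. x \<bullet> y = 0}"
    using assms(2) by (intro span_minimal subspaceI) (auto simp: Ay inner_add_left)
  then show False using * Ay[of i] by auto
qed

text \<open>
  Orthonormalising the rows is a retraction onto the orthogonal group. The segment from a matrix to its
  orthonormalisation consists of matrices that are triangular with positive diagonal with respect to
  the orthonormal rows, so it stays in the general linear group.
\<close>

theorem GL_homotopy_equivalent_orthogonal_group:
  "top_of_set (GL :: (real ^ 'd ^ 'd) set) homotopy_equivalent_space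
     (orthogonal_group :: (real ^ 'd ^ 'd) topology)"
proof -
  define n where "n = CARD('d)"
  obtain e :: "nat \<Rightarrow> 'd" where e: "bij_betw e {..<n} UNIV"
    unfolding n_def using ex_bij_betw_nat_finite[of "UNIV :: 'd set"]
    by (auto simp: atLeast0LessThan)
  define e' where "e' = inv_into {..<n} e"
  have e': "e' i < n" "e (e' i) = i" for i
    using e bij_betw_inv_into[OF e] bij_betw_inv_into_right[OF e]
    by (auto simp: e'_def bij_betw_def)
  have e'e: "e' (e k) = k" if "k < n" for k
    using that bij_betw_inv_into_left[OF e] by (simp add: e'_def)
  have inj: "e k = e j \<longleftrightarrow> k = j" if "k < n" "j < n" for k j
    using that e'e by metis
  define rows where "rows = (\<lambda>(A::real ^ 'd ^ 'd) k. A $ e k)"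
  define r where "r = (\<lambda>A. \<chi> i. gram_schmidt (rows A) (e' i))"
  have indep: "rows A k \<notin> span (rows A ` {..<k})" if "invertible A" "k < n" for A k
  proof -
    have "rows A ` {..<k} = (\<lambda>j. A $ j) ` (e ` {..<k})" by (auto simp: rows_def)
    moreover have "e k \<notin> e ` {..<k}" using inj that by auto
    ultimately show ?thesis
      using row_notin_span_of_rows[OF that(1), of "e k" "e ` {..<k}"] by (simp add: rows_def)
  qed
  have r_orth: "orthogonal_matrix (r A)" if A: "invertible A" for A
  proof -
    let ?g = "gram_schmidt (rows A)"
    have norm: "norm (?g k) = 1" if "k < n" for k
      using gram_schmidt_orthonormal(1)[of n "rows A" k] indep[OF A] that by blast
    have orth: "?g k \<bullet> ?g j = 0" if "j < k" "k < n" for j k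
      using gram_schmidt_orthonormal(2)[of n "rows A" j k] indep[OF A] that by blast
    have "?g (e' i) \<bullet> ?g (e' j) = 0" if "i \<noteq> j" for i j
    proof -
      have "e' i \<noteq> e' j" using e'(2) that by metis
      then show ?thesis
        using orth[of "e' i" "e' j"] orth[of "e' j" "e' i"] e'(1)
        by (cases "e' i" "e' j" rule: linorder_cases) (auto simp: inner_commute)
    qed
    then show ?thesis
      using norm e'(1)
      by (auto simp: orthogonal_matrix_orthonormal_rows r_def row_def orthogonal_def vec_lambda_eta)
  qed
  have r_id: "r A = A" if "orthogonal_matrix A" for A
  proof -
    have "gram_schmidt (rows A) k = rows A k" if "k < n" for k
      using \<open>orthogonal_matrix A\<close> inj that
      by (intro gram_schmidt_of_orthonormal[of n])
         (auto simp: rows_def orthogonal_matrix_orthonormal_rows row_def vec_lambda_eta orthogonal_def)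
    then show ?thesis using e' by (simp add: r_def vec_eq_iff rows_def)
  qed
  have orth_inv: "invertible A" if "orthogonal_matrix A" for A :: "real ^ 'd ^ 'd"
    using that by (auto simp: orthogonal_matrix_def invertible_def)
  \<comment> \<open>on the kernel, all orthonormal rows vanish one after the other, because each diagonal entry is positive\<close>
  have segment: "invertible ((1 - t) *\<^sub>R r A + t *\<^sub>R A)"
    if A: "invertible A" and t: "0 \<le> t" "t \<le> 1" for A t
    unfolding invertible_iff_kernel
  proof (intro allI impI)
    fix x assume x: "((1 - t) *\<^sub>R r A + t *\<^sub>R A) *v x = 0"
    let ?g = "gram_schmidt (rows A)"
    have row0: "(1 - t) * (?g k \<bullet> x) + t * (rows A k \<bullet> x) = 0" if "k < n" for k
      using arg_cong[OF x, of "\<lambda>y. y $ e k"] that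
      by (simp add: matrix_vector_mult_component inner_add_left r_def e'e rows_def)
    have both: "?g k \<bullet> x = 0 \<and> rows A k \<bullet> x = 0" if "k < n" for k
      using that
    proof (induction k rule: less_induct)
      case (less k)
      obtain c where c: "0 < c" "rows A k = c *\<^sub>R ?g k + (\<Sum>j<k. (rows A k \<bullet> ?g j) *\<^sub>R ?g j)"
        using gram_schmidt_decomposition[OF indep[OF A less.prems]] by auto
      have "rows A k \<bullet> x = c * (?g k \<bullet> x) + (\<Sum>j<k. (rows A k \<bullet> ?g j) * (?g j \<bullet> x))"
        by (subst c(2)) (simp add: inner_add_left inner_sum_left)
      also have "(\<Sum>j<k. (rows A k \<bullet> ?g j) * (?g j \<bullet> x)) = 0"
        using less by (intro sum.neutral) auto
      finally have rk: "rows A k \<bullet> x = c * (?g k \<bullet> x)" by simp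
      then have "((1 - t) + t * c) * (?g k \<bullet> x) = 0"
        using row0[OF less.prems] by (simp add: algebra_simps)
      moreover have "(1 - t) + t * c > 0"
        using t c(1) by (cases "t = 0") (auto intro: add_nonneg_pos)
      ultimately show ?case using rk by simp
    qed
    have "A *v x = 0"
      using both[OF e'(1)] by (simp add: vec_eq_iff matrix_vector_mult_component rows_def e'(2))
    then show "x = 0" using A by (simp add: invertible_iff_kernel)
  qed
  have cont: "continuous_on GL r"
    unfolding r_def using indep e'(1)
    by (intro continuous_on_vec_lambda continuous_on_gram_schmidt[of n])
       (auto simp: rows_def intro!: continuous_intros)
  have "homotopic_with_canon (\<lambda>_. True) GL GL r id"
    using segment by (intro homotopic_with_linear cont) (auto simp: closed_segment_def)
  moreover have "retraction_maps (top_of_set GL) (orthogonal_group :: (real ^ 'd ^ 'd) topology) r id"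
    using cont r_orth r_id orth_inv
    by (auto simp: retraction_maps_def orthogonal_group_def intro!: continuous_on_id)
  ultimately show ?thesis
    by (rule deformation_retract_imp_homotopy_equivalent_space)
qed

section \<open>Splitting off a frame\<close>

text \<open>
  Continuity as convergence at each point gives access to the limit rules of analysis although the
  domain is an abstract topology.
\<close>

lemma continuous_map_euclidean_iff_tendsto:
  "continuous_map X euclidean f \<longleftrightarrow> (\<forall>x\<in>topspace X. (f \<longlongrightarrow> f x) (atin X x))"
  by (simp add: continuous_map_atin)

lemma tendsto_det:
  fixes A :: "'a \<Rightarrow> real ^ 'd ^ 'd"
  assumes "(A \<longlongrightarrow> B) F"
  shows "((\<lambda>x. det (A x)) \<longlongrightarrow> det B) F"
  unfolding det_def by (intro tendsto_intros assms)

lemma matrix_inv_vector_mult: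
  fixes A :: "real ^ 'd ^ 'd"
  assumes "invertible A"
  shows "A *v (matrix_inv A *v x) = x" "matrix_inv A *v (A *v x) = x" "invertible (matrix_inv A)"
proof -
  have "A ** matrix_inv A = mat 1 \<and> matrix_inv A ** A = mat 1"
    using assms unfolding invertible_def matrix_inv_def by (rule someI_ex)
  then show "A *v (matrix_inv A *v x) = x" "matrix_inv A *v (A *v x) = x" "invertible (matrix_inv A)"
    by (auto simp: matrix_vector_mul_assoc invertible_def)
qed

text \<open>
  By Cramer's rule the entries of the solution of a linear system are quotients of determinants.
\<close>

lemma tendsto_matrix_inv_vector_mult:
  fixes A :: "'a \<Rightarrow> real ^ 'd ^ 'd"
  assumes A: "(A \<longlongrightarrow> B) F" and b: "(b \<longlongrightarrow> c) F" and inv: "invertible B"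
  shows "((\<lambda>x. matrix_inv (A x) *v b x) \<longlongrightarrow> matrix_inv B *v c) F"
proof -
  define solve where "solve = (\<lambda>(A::real ^ 'd ^ 'd) b. \<chi> k. det (\<chi> i j. if j = k then b $ i else A $ i $ j) / det A)"
  have solve: "matrix_inv A *v b = solve A b" if "det A \<noteq> 0" for A b
    using cramer[OF that, of "matrix_inv A *v b" b] that
    by (simp add: matrix_inv_vector_mult invertible_det_nz solve_def)
  have det: "det B \<noteq> 0" using inv by (simp add: invertible_det_nz)
  have entry: "((\<lambda>x. if j = k then b x $ i else A x $ i $ j) \<longlongrightarrow> (if j = k then c $ i else B $ i $ j)) F"
    for i j k
    by (cases "j = k") (auto intro!: tendsto_intros A b)
  have "((\<lambda>x. solve (A x) (b x)) \<longlongrightarrow> solve B c) F"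
    unfolding solve_def by (intro tendsto_intros tendsto_det A entry det)
  moreover have "\<forall>\<^sub>F x in F. solve (A x) (b x) = matrix_inv (A x) *v b x"
    using tendsto_imp_eventually_ne[OF tendsto_det[OF A] det]
    by eventually_elim (simp add: solve)
  ultimately show ?thesis
    using solve[OF det] by (simp add: tendsto_cong)
qed

lemma prod_contractible_homotopy_equivalent:
  assumes "contractible_space Y" and "topspace Y \<noteq> {}"
  shows "prod_topology X Y homotopy_equivalent_space X"
proof -
  obtain a where a: "a \<in> topspace Y" "homotopic_with (\<lambda>x. True) Y Y id (\<lambda>x. a)"
    using assms unfolding contractible_space by force
  have "homotopic_with (\<lambda>x. True) (prod_topology X Y) (prod_topology X Y)
     (\<lambda>z. (id (fst z), id (snd z))) (\<lambda>z. (id (fst z), a))"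
    by (rule homotopic_with_prod_topology[OF _ a(2)]) auto
  then have "homotopic_with (\<lambda>x. True) (prod_topology X Y) (prod_topology X Y)
      ((\<lambda>x. (x, a)) \<circ> fst) id"
    by (simp add: homotopic_with_sym o_def id_def)
  moreover have "retraction_maps (prod_topology X Y) X fst (\<lambda>x. (x, a))"
    using a(1) by (auto simp: retraction_maps_def intro!: continuous_intros)
  ultimately show ?thesis
    by (rule deformation_retraction_imp_homotopy_equivalent_space)
qed

text \<open>
  If the vectors at the vertices \<open>\<beta> j\<close> always form a basis and \<open>C\<close> is invariant under linear changes of
  coordinates, then a configuration is the same thing as a basis together with a configuration in
  which this basis is the standard one. The space is therefore a product of the general linear group
  and the normalised configurations, and the second factor is contractible by assumption.
\<close>

theorem frame_splitting:
  fixes C :: "('v \<Rightarrow> real ^ 'd) set" and \<beta> :: "'d::finite \<Rightarrow> 'v"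
  assumes C: "C \<subseteq> V \<rightarrow>\<^sub>E UNIV" and \<beta>: "range \<beta> \<subseteq> V"
    and act: "\<And>w A. w \<in> C \<Longrightarrow> invertible A \<Longrightarrow> (\<lambda>v\<in>V. A *v w v) \<in> C"
    and frame: "\<And>w. w \<in> C \<Longrightarrow> invertible (\<chi> i j. w (\<beta> j) $ i)"
    and contr: "contractible_space (subtopology (product_topology (\<lambda>_. euclidean) V)
                  {w \<in> C. \<forall>j. w (\<beta> j) = axis j 1})"
    and ne: "{w \<in> C. \<forall>j. w (\<beta> j) = axis j 1} \<noteq> {}"
  shows "subtopology (product_topology (\<lambda>_. euclidean) V) C
           homotopy_equivalent_space top_of_set (GL :: (real ^ 'd ^ 'd) set)"
proof -
  let ?P = "product_topology (\<lambda>_. euclidean :: (real ^ 'd) topology) V"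
  let ?N = "{w \<in> C. \<forall>j. w (\<beta> j) = axis j 1}"
  let ?X = "subtopology ?P C" and ?Y = "prod_topology (top_of_set (GL :: (real ^ 'd ^ 'd) set)) (subtopology ?P ?N)"
  define M where "M = (\<lambda>w::'v \<Rightarrow> real ^ 'd. \<chi> i j. w (\<beta> j) $ i)"
  define f where "f = (\<lambda>w. (M w, \<lambda>v\<in>V. matrix_inv (M w) *v w v))"
  define g where "g = (\<lambda>(A::real ^ 'd ^ 'd, u::'v \<Rightarrow> real ^ 'd). \<lambda>v\<in>V. A *v u v)"
  have top: "topspace ?X = C" "topspace ?Y = GL \<times> ?N"
    using C by auto
  have M_axis: "M w *v axis j 1 = w (\<beta> j)" for w j
    by (simp add: M_def vec_eq_iff matrix_vector_mult_def axis_def if_distrib[of "\<lambda>x. _ * x"] cong: if_cong)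
  have inv: "invertible (M w)" "invertible (matrix_inv (M w))" if "w \<in> C" for w
    using frame[OF that] by (auto simp: M_def matrix_inv_vector_mult)
  have \<beta>V: "\<beta> j \<in> V" for j using \<beta> by auto
  have fC: "f w \<in> GL \<times> ?N" if "w \<in> C" for w
  proof -
    have "matrix_inv (M w) *v w (\<beta> j) = axis j 1" for j
      using matrix_inv_vector_mult(2)[OF inv(1)[OF that], of "axis j 1"] by (simp add: M_axis)
    then show ?thesis
      using act[OF that inv(2)[OF that]] inv[OF that] \<beta>V by (auto simp: f_def)
  qed
  have gN: "g (A, u) \<in> C" if "invertible A" "u \<in> C" for A u
    using act[OF that(2,1)] by (simp add: g_def)
  have gf: "g (f w) = w" if "w \<in> C" for w
  proof -
    have "w \<in> extensional V" using subsetD[OF C that] by (simp add: PiE_def)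
    then show ?thesis
      using matrix_inv_vector_mult(1)[OF inv(1)[OF that]]
      by (auto simp: f_def g_def fun_eq_iff extensional_def)
  qed
  have fg: "f (g (A, u)) = (A, u)" if A: "invertible A" and u: "u \<in> ?N" for A u
  proof -
    have "M (g (A, u)) = A"
      using u \<beta>V by (simp add: M_def g_def vec_eq_iff matrix_vector_mult_def axis_def
          if_distrib[of "\<lambda>x. _ * x"] cong: if_cong)
    moreover have "u \<in> extensional V" using subsetD[OF C, of u] u by (simp add: PiE_def)
    ultimately show ?thesis
      using matrix_inv_vector_mult(2)[OF A]
      by (auto simp: f_def g_def fun_eq_iff extensional_def)
  qed
  have proj: "((\<lambda>w. w v) \<longlongrightarrow> w v) (atin ?X w)" if "w \<in> C" "v \<in> V" for w v
  proof -
    have "continuous_map ?X euclidean (\<lambda>w. w v)"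
      using that by (intro continuous_map_from_subtopology continuous_map_product_projection)
    then show ?thesis using that top by (simp add: continuous_map_euclidean_iff_tendsto)
  qed
  have M_lim: "(M \<longlongrightarrow> M w) (atin ?X w)" if "w \<in> C" for w
    unfolding M_def by (intro tendsto_intros proj that \<beta>V)
  have "continuous_map ?X ?Y f"
    unfolding f_def
  proof (intro continuous_map_pairedI)
    show "continuous_map ?X (top_of_set GL) M"
      using inv by (auto simp: continuous_map_in_subtopology continuous_map_euclidean_iff_tendsto
          top(1) M_lim)
    have "continuous_map ?X ?P (\<lambda>w. \<lambda>v\<in>V. matrix_inv (M w) *v w v)"
      unfolding continuous_map_componentwise continuous_map_euclidean_iff_tendsto top(1)
      using inv by (auto intro!: tendsto_matrix_inv_vector_mult proj M_lim)
    then show "continuous_map ?X (subtopology ?P ?N) (\<lambda>w. \<lambda>v\<in>V. matrix_inv (M w) *v w v)"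
      using fC by (auto simp: continuous_map_in_subtopology f_def)
  qed
  moreover have "continuous_map ?Y ?X g"
  proof -
    have fst: "(fst \<longlongrightarrow> A) (atin ?Y (A, u))" if "invertible A" "u \<in> ?N" for A u
    proof -
      have "continuous_map ?Y euclidean fst"
        by (rule continuous_map_into_fulltopology[OF continuous_map_fst])
      then have "\<forall>z\<in>GL \<times> ?N. (fst \<longlongrightarrow> fst z) (atin ?Y z)"
        by (simp only: continuous_map_euclidean_iff_tendsto top(2))
      from bspec[OF this, of "(A, u)"] that show ?thesis by simp
    qed
    have snd: "((\<lambda>z. snd z v) \<longlongrightarrow> u v) (atin ?Y (A, u))" if "invertible A" "u \<in> ?N" "v \<in> V" for A u v
    proof -
      have "continuous_map ?Y ?P snd"
        by (rule continuous_map_into_fulltopology[OF continuous_map_snd])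
      then have "continuous_map ?Y euclidean ((\<lambda>w. w v) \<circ> snd)"
        by (rule continuous_map_compose[OF _ continuous_map_product_projection[OF that(3)]])
      then have "\<forall>z\<in>GL \<times> ?N. ((\<lambda>z. snd z v) \<longlongrightarrow> snd z v) (atin ?Y z)"
        by (simp only: continuous_map_euclidean_iff_tendsto top(2) o_def)
      from bspec[OF this, of "(A, u)"] that(1,2) show ?thesis by simp
    qed
    have lim: "((\<lambda>z. fst z *v snd z v) \<longlongrightarrow> A *v u v) (atin ?Y (A, u))"
      if "invertible A" "u \<in> ?N" "v \<in> V" for A u v
      unfolding matrix_vector_mult_def by (intro tendsto_intros fst[OF that(1,2)] snd[OF that])
    have "continuous_map ?Y ?P g"
      unfolding continuous_map_componentwise continuous_map_euclidean_iff_tendsto top(2)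
      using lim by (auto simp: g_def case_prod_unfold)
    then show ?thesis
      using gN top(2) by (auto simp: continuous_map_in_subtopology)
  qed
  ultimately have "homeomorphic_maps ?X ?Y f g"
    using fg gf by (auto simp: homeomorphic_maps_def top)
  then have "?X homotopy_equivalent_space ?Y"
    by (intro homeomorphic_imp_homotopy_equivalent_space) (auto simp: homeomorphic_space_def)
  also have "?Y homotopy_equivalent_space top_of_set (GL :: (real ^ 'd ^ 'd) set)"
  proof (rule prod_contractible_homotopy_equivalent[OF contr])
    have "topspace (subtopology ?P ?N) = ?N" using C by auto
    then show "topspace (subtopology ?P ?N) \<noteq> {}" using ne by simp
  qed
  finally show ?thesis .
qed

lemma fan_injective_linear_image:
  fixes w :: "'v \<Rightarrow> real ^ 'd" and A :: "real ^ 'd ^ 'd"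
  assumes "fan_injective L w" and A: "invertible A"
  shows "fan_injective L (\<lambda>v\<in>vertices L. A *v w v)"
  unfolding fan_injective_def
proof (intro allI impI)
  fix z :: "'v \<Rightarrow> real"
  assume z: "{v. 0 < z v} \<in> L" "{v. z v < 0} \<in> L"
    and "(\<Sum>v\<in>vertices L. z v *\<^sub>R (\<lambda>v\<in>vertices L. A *v w v) v) = 0"
  then have "A *v (\<Sum>v\<in>vertices L. z v *\<^sub>R w v) = 0"
    by (simp add: linear_sum[OF matrix_vector_mul_linear] matrix_vector_mult_scaleR)
  then have "(\<Sum>v\<in>vertices L. z v *\<^sub>R w v) = 0"
    using A unfolding invertible_iff_kernel by blast
  then show "z = (\<lambda>_. 0)"
    using assms(1) z unfolding fan_injective_def by blast
qed

text \<open>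
  A relation supported on one simplex has its positive and negative support in that simplex.
\<close>

lemma fan_injective_independent_on_simplex:
  assumes L: "finite_complex L" and inj: "fan_injective L w" and s: "s \<in> L"
    and c: "(\<Sum>v\<in>s. c v *\<^sub>R w v) = 0" and v: "v \<in> s"
  shows "c v = 0"
proof -
  define z where "z = (\<lambda>v. if v \<in> s then c v else 0)"
  have "{v. 0 < z v} \<in> L" "{v. z v < 0} \<in> L"
    by (auto intro!: finite_complex_subset[OF L s] simp: z_def split: if_splits)
  moreover have "(\<Sum>v\<in>vertices L. z v *\<^sub>R w v) = (\<Sum>v\<in>s. c v *\<^sub>R w v)"
    using simplex_subset_vertices[OF L s] finite_vertices[OF L]
    by (intro sum.mono_neutral_cong_right) (auto simp: z_def)
  ultimately have "z = (\<lambda>_. 0)"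
    using inj c unfolding fan_injective_def by simp
  then show ?thesis using v by (metis z_def)
qed

text \<open>
  The reduction used for both families of spheres: the images of the vertices of a top-dimensional
  simplex \<open>range \<beta>\<close> form a basis, so only the contractibility of the space of flattenings that are
  standard on this simplex has to be shown.
\<close>

theorem flattening_space_homotopy_equivalent_orthogonal_group:
  fixes L :: "'v set set" and \<beta> :: "'d::finite \<Rightarrow> 'v"
  defines "N \<equiv> {w \<in> vertices L \<rightarrow>\<^sub>E UNIV. fan_injective L w \<and> (\<forall>j. w (\<beta> j) = (axis j 1 :: real ^ 'd))}"
  assumes L: "finite_complex L" and \<beta>: "inj \<beta>" "range \<beta> \<in> L"
    and contr: "contractible_space (subtopology (product_topology (\<lambda>_. euclidean) (vertices L)) N)"
    and ne: "N \<noteq> {}"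
  shows "(flattening_space L :: ('v \<Rightarrow> real ^ 'd) topology) homotopy_equivalent_space
           (orthogonal_group :: (real ^ 'd ^ 'd) topology)"
proof -
  let ?C = "{w \<in> vertices L \<rightarrow>\<^sub>E (UNIV :: (real ^ 'd) set). fan_injective L w}"
  have N: "{w \<in> ?C. \<forall>j. w (\<beta> j) = axis j 1} = N" by (auto simp: N_def)
  have "invertible (\<chi> i j. w (\<beta> j) $ i)" if w: "w \<in> ?C" for w
    unfolding invertible_iff_kernel
  proof (intro allI impI)
    fix x assume x: "(\<chi> i j. w (\<beta> j) $ i) *v x = 0"
    have "(\<Sum>v\<in>range \<beta>. (x $ inv \<beta> v) *\<^sub>R w v) = (\<Sum>j\<in>UNIV. (x $ j) *\<^sub>R w (\<beta> j))"
      using \<beta>(1) by (subst sum.reindex) auto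
    also have "\<dots> = 0"
      using x by (simp add: vec_eq_iff matrix_vector_mult_def mult.commute)
    finally have "x $ inv \<beta> (\<beta> j) = 0" for j
      using fan_injective_independent_on_simplex[OF L _ \<beta>(2), of w "\<lambda>v. x $ inv \<beta> v" "\<beta> j"] w
      by auto
    then show "x = 0" using \<beta>(1) by (simp add: vec_eq_iff)
  qed
  moreover have "(\<lambda>v\<in>vertices L. A *v w v) \<in> ?C" if "w \<in> ?C" "invertible A" for w A
    using fan_injective_linear_image[of L w A] that by simp
  ultimately have "(flattening_space L :: ('v \<Rightarrow> real ^ 'd) topology) homotopy_equivalent_space top_of_set (GL :: (real ^ 'd ^ 'd) set)"
    unfolding flattening_space_eq[OF L]
    using contr ne simplex_subset_vertices[OF L \<beta>(2)]
    by (intro frame_splitting[of _ _ \<beta>]; (unfold N)?) auto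
  also note GL_homotopy_equivalent_orthogonal_group
  finally show ?thesis .
qed

section \<open>Contractions given coordinate by coordinate\<close>

lemma contractible_by_homotopy:
  assumes "continuous_map (prod_topology (top_of_set {0..1::real}) X) X h"
    and "\<And>x. x \<in> topspace X \<Longrightarrow> h (0, x) = x"
    and "\<And>x. x \<in> topspace X \<Longrightarrow> h (1, x) = a"
  shows "contractible_space X"
proof -
  have "homotopic_with (\<lambda>x. True) X X id (\<lambda>x. a)"
    using assms by (subst homotopic_with) (auto intro!: exI[of _ h])
  then show ?thesis unfolding contractible_space_def by blast
qed

text \<open>
  A contraction that moves every coordinate on its own. Continuity is required only on the values that
  the coordinate takes on \<open>S\<close>, because the formula used for cycles involves the argument of a complex
  number and is continuous only away from a ray.
\<close>

lemma contractible_subset_of_product: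
  fixes S :: "('v \<Rightarrow> real ^ 'd) set" and h :: "'v \<Rightarrow> real \<Rightarrow> real ^ 'd \<Rightarrow> real ^ 'd"
  assumes S: "S \<subseteq> V \<rightarrow>\<^sub>E UNIV"
    and h: "\<And>t w. 0 \<le> t \<Longrightarrow> t \<le> 1 \<Longrightarrow> w \<in> S \<Longrightarrow> (\<lambda>v\<in>V. h v t (w v)) \<in> S"
    and cont: "\<And>v. v \<in> V \<Longrightarrow> continuous_on ({0..1} \<times> (\<lambda>w. w v) ` S) (\<lambda>(t, x). h v t x)"
    and h0: "\<And>w v. w \<in> S \<Longrightarrow> v \<in> V \<Longrightarrow> h v 0 (w v) = w v"
    and h1: "\<And>w v. w \<in> S \<Longrightarrow> v \<in> V \<Longrightarrow> h v 1 (w v) = a v"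
  shows "contractible_space (subtopology (product_topology (\<lambda>_. euclidean) V) S)"
proof (rule contractible_by_homotopy)
  let ?P = "product_topology (\<lambda>_. euclidean :: (real ^ 'd) topology) V"
  let ?X = "subtopology ?P S" and ?I = "top_of_set {0..1::real}"
  let ?H = "\<lambda>z. \<lambda>v\<in>V. h v (fst z) (snd z v)"
  have top: "topspace ?X = S" using S by auto
  have coord: "continuous_map (prod_topology ?I ?X) euclidean (\<lambda>z. h v (fst z) (snd z v))"
    if v: "v \<in> V" for v
  proof -
    have "continuous_map ?X (top_of_set ((\<lambda>w. w v) ` S)) (\<lambda>w. w v)"
      using continuous_map_from_subtopology[OF continuous_map_product_projection[OF v]] top
      by (auto simp: continuous_map_in_subtopology)
    then have "continuous_map (prod_topology ?I ?X) (top_of_set ((\<lambda>w. w v) ` S)) (\<lambda>z. snd z v)"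
      using continuous_map_compose[OF continuous_map_snd, of ?X _ "\<lambda>w. w v" ?I] by (simp add: o_def)
    then have "continuous_map (prod_topology ?I ?X) (prod_topology ?I (top_of_set ((\<lambda>w. w v) ` S)))
        (\<lambda>z. (fst z, snd z v))"
      by (intro continuous_map_pairedI continuous_map_fst)
    moreover have "continuous_map (prod_topology ?I (top_of_set ((\<lambda>w. w v) ` S))) euclidean (\<lambda>(t, x). h v t x)"
      using cont[OF v] by simp
    ultimately have "continuous_map (prod_topology ?I ?X) euclidean ((\<lambda>(t, x). h v t x) \<circ> (\<lambda>z. (fst z, snd z v)))"
      by (rule continuous_map_compose)
    then show ?thesis by (simp add: o_def)
  qed
  have "continuous_map (prod_topology ?I ?X) ?P ?H"
    using coord by (auto simp: continuous_map_componentwise)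
  then show "continuous_map (prod_topology ?I ?X) ?X ?H"
    using h top by (auto simp: continuous_map_in_subtopology)
  show "?H (0, w) = w" if "w \<in> topspace ?X" for w
  proof -
    have "w \<in> S" using that top by simp
    then show ?thesis using h0 subsetD[OF S, of w] by (auto simp: fun_eq_iff PiE_def extensional_def)
  qed
  show "?H (1, w) = restrict a V" if "w \<in> topspace ?X" for w
    using that top h1 by (auto simp: fun_eq_iff)
qed

section \<open>The suspension of the boundary of a simplex\<close>

text \<open>
  The linear relations between the \<open>n + 4\<close> vectors of a normalised configuration form a plane with
  coordinates \<open>s\<close> and \<open>t\<close>, the coefficients at the two vertices outside the standard simplex. The
  left-hand side says that each nonzero relation is positive or negative on one of the two missing
  faces of the complex. A relation violating this amounts to two inequalities between products, and
  multiplying them shows that it exists as soon as the right-hand side fails and only then.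
\<close>

lemma suspension_sign_condition:
  fixes p c :: real and q l :: "'i \<Rightarrow> real"
  assumes J: "J \<noteq> {}"
  shows "(\<forall>s t. (0 < s * p - t * c \<and> 0 < s) \<or> (s * p - t * c < 0 \<and> s < 0) \<or>
            (0 < t \<and> (\<forall>j\<in>J. 0 < t * l j - s * q j)) \<or> (t < 0 \<and> (\<forall>j\<in>J. t * l j - s * q j < 0)) \<or>
            (s = 0 \<and> t = 0))
     \<longleftrightarrow> 0 < p \<and> (\<forall>j\<in>J. 0 < l j \<and> c * q j < p * l j)" (is "(\<forall>s t. ?A s t) \<longleftrightarrow> ?B")
proof
  assume A: "\<forall>s t. ?A s t"
  have p: "0 < p" using A[rule_format, of 1 0] by simp
  moreover have l: "0 < l j" if "j \<in> J" for j
    using A[rule_format, of 0 1] that by auto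
  moreover have "c * q j < p * l j" if j: "j \<in> J" for j
  proof -
    \<comment> \<open>the relation with \<open>s = c\<close>, \<open>t = p\<close> has coefficient \<open>0\<close> at the suspension point of the frame\<close>
    have "0 < p * l j - c * q j"
      using A[rule_format, of c p] p j by (auto simp: mult.commute)
    then show ?thesis by simp
  qed
  ultimately show ?B by blast
next
  assume B: ?B
  show "\<forall>s t. ?A s t"
  proof (intro allI)
    fix s t :: real
    have key: False if st: "s * p \<le> t * c" "0 < s" "t * l j \<le> s * q j" "0 < t" "j \<in> J" for s t j
    proof -
      have pos: "0 < s * p" "0 < t * l j" "0 < s * t" using st B by auto
      then have "(s * p) * (t * l j) \<le> (t * c) * (s * q j)"
        using mult_mono[OF st(1,3)] st(1) by linarith
      then have "(s * t) * (p * l j) \<le> (s * t) * (c * q j)" by (simp add: algebra_simps)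
      then show False using pos st B by (metis mult_le_cancel_left_pos not_less)
    qed
    have key': False if st: "s * p \<le> t * c" "0 < s" "s * q j \<le> t * l j" "t < 0" "j \<in> J" for s t j
    proof -
      have st': "(- t) * l j \<le> (- s) * q j" using st(3) by simp
      have pos: "0 < s * p" "0 < (- t) * l j" "0 < s * (- t)"
        using st B by (auto simp: mult_neg_pos mult_pos_neg)
      then have "(s * p) * ((- t) * l j) \<le> (t * c) * ((- s) * q j)"
        using mult_mono[OF st(1) st'] st(1) by linarith
      then have "(s * (- t)) * (p * l j) \<le> (s * (- t)) * (c * q j)" by (simp add: algebra_simps)
      then show False using pos st B by (metis mult_le_cancel_left_pos not_less)
    qed
    show "?A s t"
    proof (rule ccontr)
      assume nA: "\<not> ?A s t"
      have s: "s \<noteq> 0" "t \<noteq> 0"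
        using nA B J by (auto simp: linorder_neq_iff zero_less_mult_iff mult_less_0_iff)
      obtain j where j: "j \<in> J" "0 < t \<Longrightarrow> t * l j \<le> s * q j" "t < 0 \<Longrightarrow> s * q j \<le> t * l j"
        using nA s(2) by (cases "0 < t") (auto simp: not_less)
      show False
        using key[of s t j] key[of "-s" "-t" j] key'[of s t j] key'[of "-s" "-t" j] nA s j
        by (auto simp: linorder_neq_iff not_less)
    qed
  qed
qed

lemma finite_complex_simplex_boundary: "finite_complex (simplex_boundary m)"
proof -
  have "finite (simplex_boundary m)"
    by (rule finite_subset[of _ "Pow {0..m}"]) (auto simp: simplex_boundary_def)
  then show ?thesis
    by (auto simp: finite_complex_def simplex_boundary_def intro: finite_subset)
qed

lemma mem_simplicial_join_iff: "s \<in> simplicial_join K L \<longleftrightarrow> Inl -` s \<in> K \<and> Inr -` s \<in> L"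
proof
  show "s \<in> simplicial_join K L \<Longrightarrow> Inl -` s \<in> K \<and> Inr -` s \<in> L"
  proof -
    assume "s \<in> simplicial_join K L"
    then obtain a b where ab: "s = a <+> b" "a \<in> K" "b \<in> L"
      unfolding simplicial_join_def by blast
    moreover have "Inl -` s = a" "Inr -` s = b" using ab(1) by auto
    ultimately show ?thesis by simp
  qed
next
  have "v \<in> s \<longleftrightarrow> v \<in> Inl -` s <+> Inr -` s" for v
    by (cases v) auto
  then have "s = Inl -` s <+> Inr -` s" by blast
  moreover assume "Inl -` s \<in> K \<and> Inr -` s \<in> L"
  ultimately show "s \<in> simplicial_join K L"
    unfolding simplicial_join_def by blast
qed

lemma finite_complex_simplicial_join:
  assumes "finite_complex K" "finite_complex L"
  shows "finite_complex (simplicial_join K L)"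
proof -
  have "simplicial_join K L = (\<lambda>(s, t). s <+> t) ` (K \<times> L)"
    unfolding simplicial_join_def by auto
  then have "finite (simplicial_join K L)" "\<And>s. s \<in> simplicial_join K L \<Longrightarrow> finite s"
    using assms by (auto simp: finite_complex_def)
  moreover have "t \<in> simplicial_join K L" if "s \<in> simplicial_join K L" "t \<subseteq> s" for s t
    using that finite_complex_subset[OF assms(1), of "Inl -` s" "Inl -` t"]
      finite_complex_subset[OF assms(2), of "Inr -` s" "Inr -` t"]
    by (auto simp: mem_simplicial_join_iff)
  moreover have "{} \<in> simplicial_join K L"
    using assms by (simp add: finite_complex_def mem_simplicial_join_iff)
  ultimately show ?thesis
    unfolding finite_complex_def by blast
qed

abbreviation suspended_boundary :: "nat \<Rightarrow> (nat + nat) set set" where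
  "suspended_boundary n \<equiv> simplicial_join (simplex_boundary 1) (simplex_boundary (n + 1))"

text \<open>
  The complex has exactly two minimal missing faces: the two suspension points, and all vertices of the
  simplex.
\<close>

lemma mem_suspended_boundary_iff:
  "s \<in> suspended_boundary n \<longleftrightarrow> s \<subseteq> {0, 1} <+> {0..n + 1} \<and>
     \<not> {Inl 0, Inl 1} \<subseteq> s \<and> \<not> Inr ` {0..n + 1} \<subseteq> s"
proof -
  have interval: "{0..1::nat} = {0, 1}" by auto
  have sub: "s \<subseteq> A <+> B \<longleftrightarrow> Inl -` s \<subseteq> A \<and> Inr -` s \<subseteq> B" for A B
  proof (intro iffI subsetI)
    fix v assume "Inl -` s \<subseteq> A \<and> Inr -` s \<subseteq> B" "v \<in> s"
    then show "v \<in> A <+> B" by (cases v) auto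
  qed auto
  have left: "Inl -` s \<subset> {0, 1} \<longleftrightarrow> Inl -` s \<subseteq> {0, 1} \<and> \<not> {Inl 0, Inl 1} \<subseteq> s"
    by auto
  have right: "Inr -` s \<subset> {0..n + 1} \<longleftrightarrow> Inr -` s \<subseteq> {0..n + 1} \<and> \<not> Inr ` {0..n + 1} \<subseteq> s"
    by auto
  show ?thesis
    unfolding mem_simplicial_join_iff simplex_boundary_def mem_Collect_eq interval sub left right
    by argo
qed

lemma vertices_suspended_boundary: "vertices (suspended_boundary n) = {0, 1} <+> {0..n + 1}"
proof -
  have "\<not> {Inl 0, Inl 1} \<subseteq> {v :: nat + nat}" for v by auto
  moreover have "\<not> Inr ` {0..n + 1} \<subseteq> {v :: nat + nat}" for v
  proof
    assume "Inr ` {0..n + 1} \<subseteq> {v}"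
    then have "Inr x = v" if "x \<in> {0..n + 1}" for x using that by blast
    from this[of 0] this[of 1] show False by auto
  qed
  ultimately show ?thesis
    unfolding vertices_def mem_suspended_boundary_iff by blast
qed

lemma finite_complex_suspended_boundary: "finite_complex (suspended_boundary n)"
  by (intro finite_complex_simplicial_join finite_complex_simplex_boundary)

text \<open>
  In a configuration with \<open>a\<^sub>0\<close>, \<open>b\<^sub>j\<close> (\<open>j \<in> J\<close>) standard, the remaining vectors are written as
  \<open>a\<^sub>1 = - p a\<^sub>0 + \<Sum> q\<^sub>j b\<^sub>j\<close> and \<open>b = c a\<^sub>0 - \<Sum> l\<^sub>j b\<^sub>j\<close>.
\<close>

definition suspension_signs :: "real \<Rightarrow> real \<Rightarrow> ('i \<Rightarrow> real) \<Rightarrow> ('i \<Rightarrow> real) \<Rightarrow> 'i set \<Rightarrow> bool" where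
  "suspension_signs p c q l J \<longleftrightarrow> 0 < p \<and> (\<forall>j\<in>J. 0 < l j \<and> c * q j < p * l j)"

text \<open>
  The conditions are quadratic, but moving straight towards \<open>p = 1\<close>, \<open>c = 0\<close>, \<open>q = 0\<close>, \<open>l = 1\<close> scales
  the left-hand side of the quadratic inequality by \<open>(1 - t)\<^sup>2\<close>, while its right-hand side keeps that
  multiple of its old value and gains terms that are positive for \<open>t > 0\<close>.
\<close>

lemma suspension_signs_star_shaped:
  assumes "suspension_signs p c q l J" and t: "0 \<le> t" "t \<le> 1"
  shows "suspension_signs ((1 - t) * p + t) ((1 - t) * c) (\<lambda>j. (1 - t) * q j) (\<lambda>j. (1 - t) * l j + t) J"
proof -
  have pos: "0 < (1 - t) * x + t" if "0 < x" for x
    using that t by (cases "t = 0") (auto intro: add_nonneg_pos)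
  have "(1 - t) * c * ((1 - t) * q j) < ((1 - t) * p + t) * ((1 - t) * l j + t)"
    if p: "0 < p" "0 < l j" "c * q j < p * l j" for j
  proof (cases "t = 0")
    case False
    have "(1 - t) * (1 - t) * (c * q j) \<le> (1 - t) * (1 - t) * (p * l j)"
      using p(3) by (intro mult_left_mono) auto
    moreover have "0 < t * t" "0 \<le> (1 - t) * t * (p + l j)"
      using False t p by auto
    ultimately show ?thesis by (simp add: algebra_simps)
  qed (use p in simp)
  then show ?thesis
    using assms(1) pos unfolding suspension_signs_def by auto
qed

text \<open>
  The simplex used as a frame consists of one suspension point and all but one vertex of the boundary.
  Normalised flattenings are star-shaped about the configuration in which the other suspension point is
  opposite to the first and the remaining vertex is minus the sum of the frame vectors \<open>b\<^sub>j\<close>.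
\<close>

theorem flattening_space_suspended_boundary:
  assumes card: "CARD('d::finite) = n + 2"
  shows "(flattening_space (suspended_boundary n) :: (nat + nat \<Rightarrow> real ^ 'd) topology)
           homotopy_equivalent_space (orthogonal_group :: (real ^ 'd ^ 'd) topology)"
proof -
  let ?L = "suspended_boundary n"
  let ?V = "vertices ?L"
  obtain i0 :: 'd where True by simp
  define J where "J = UNIV - {i0}"
  have "card J = card {0..n}" using card by (simp add: J_def card_Diff_singleton)
  then obtain g where g: "bij_betw g J {0..n}"
    using finite_same_card_bij[of J "{0..n}"] by auto
  define \<beta> :: "'d \<Rightarrow> nat + nat" where "\<beta> = (\<lambda>j. if j \<in> J then Inr (g j) else Inl 0)"
  define a b :: "nat + nat" where "a = Inl 1" and "b = Inr (n + 1)"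
  have \<beta>J: "\<beta> ` J = Inr ` {0..n}" and \<beta>0: "\<beta> i0 = Inl 0"
    using g by (auto simp: \<beta>_def J_def bij_betw_def image_image[of Inr g, symmetric])
  have UNIV: "UNIV = insert i0 J" "i0 \<notin> J" by (auto simp: J_def)
  have range: "range \<beta> = insert (Inl 0) (Inr ` {0..n})"
    by (simp only: UNIV(1) image_insert \<beta>J \<beta>0)
  have inj: "inj \<beta>"
  proof (rule injI)
    fix i j assume "\<beta> i = \<beta> j"
    then show "i = j"
      using g by (cases "i \<in> J"; cases "j \<in> J") (auto simp: \<beta>_def J_def bij_betw_def inj_on_def)
  qed
  have interval: "{0..n + 1} = insert (n + 1) {0..n}" by auto
  have V: "?V = insert a (insert b (range \<beta>))"
    unfolding vertices_suspended_boundary range Plus_def interval a_def b_def by auto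
  have notin: "a \<notin> range \<beta>" "b \<notin> range \<beta>"
    unfolding range a_def b_def by auto
  have \<beta>L: "range \<beta> \<in> ?L"
    unfolding mem_suspended_boundary_iff range interval by auto
  have mem_L: "s \<in> ?L \<longleftrightarrow> s \<subseteq> ?V \<and> \<not> (\<beta> i0 \<in> s \<and> a \<in> s) \<and> \<not> (b \<in> s \<and> (\<forall>j\<in>J. \<beta> j \<in> s))" for s
  proof -
    have "Inr ` {0..n + 1} = insert b (\<beta> ` J)" unfolding \<beta>J interval b_def by simp
    then show ?thesis
      unfolding mem_suspended_boundary_iff vertices_suspended_boundary \<beta>0 a_def by auto
  qed
  have ab: "a \<noteq> b" by (simp add: a_def b_def)
  have sum_V: "(\<Sum>v\<in>?V. z v *\<^sub>R w v) = 0 \<longleftrightarrow> (\<forall>j. z (\<beta> j) = - z a * w a $ j - z b * w b $ j)"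
    if w: "\<And>j. w (\<beta> j) = axis j 1" for z and w :: "nat + nat \<Rightarrow> real ^ 'd"
  proof -
    have "(\<Sum>v\<in>?V. z v *\<^sub>R w v) = z a *\<^sub>R w a + (z b *\<^sub>R w b + (\<Sum>v\<in>range \<beta>. z v *\<^sub>R w v))"
      unfolding V using notin ab by (subst sum.insert; simp)+
    also have "(\<Sum>v\<in>range \<beta>. z v *\<^sub>R w v) = (\<Sum>j\<in>UNIV. z (\<beta> j) *\<^sub>R axis j 1)"
      using inj by (subst sum.reindex) (auto simp: w)
    also have "\<dots> = (\<chi> j. z (\<beta> j))"
      by (simp add: vec_eq_iff axis_def if_distrib[of "\<lambda>x. _ * x"] cong: if_cong)
    finally show ?thesis
      by (auto simp: vec_eq_iff algebra_simps eq_neg_iff_add_eq_0)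
  qed
  define signs where "signs = (\<lambda>w :: nat + nat \<Rightarrow> real ^ 'd.
    suspension_signs (- w a $ i0) (w b $ i0) (\<lambda>j. w a $ j) (\<lambda>j. - w b $ j) J)"
  have fan_iff: "fan_injective ?L w \<longleftrightarrow> signs w" if w: "\<And>j. w (\<beta> j) = axis j 1" for w
  proof -
    have J: "J \<noteq> {}" using \<open>card J = card {0..n}\<close> by auto
    define A where "A = (\<lambda>s t. (0 < s * (- w a $ i0) - t * w b $ i0 \<and> 0 < s) \<or>
      (s * (- w a $ i0) - t * w b $ i0 < 0 \<and> s < 0) \<or>
      (0 < t \<and> (\<forall>j\<in>J. 0 < t * (- w b $ j) - s * w a $ j)) \<or>
      (t < 0 \<and> (\<forall>j\<in>J. t * (- w b $ j) - s * w a $ j < 0)) \<or> (s = 0 \<and> t = 0))"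
    have A_eq: "A s t \<longleftrightarrow> (0 < - s * w a $ i0 - t * w b $ i0 \<and> 0 < s) \<or>
      (- s * w a $ i0 - t * w b $ i0 < 0 \<and> s < 0) \<or>
      (0 < t \<and> (\<forall>j\<in>J. 0 < - s * w a $ j - t * w b $ j)) \<or>
      (t < 0 \<and> (\<forall>j\<in>J. - s * w a $ j - t * w b $ j < 0)) \<or> (s = 0 \<and> t = 0)" for s t
    proof -
      have "s * (- w a $ i0) - t * w b $ i0 = - s * w a $ i0 - t * w b $ i0"
        "t * (- w b $ j) - s * w a $ j = - s * w a $ j - t * w b $ j" for j
        by simp_all
      then show ?thesis unfolding A_def by (simp only:)
    qed
    have signs: "signs w \<longleftrightarrow> (\<forall>s t. A s t)"
      unfolding signs_def suspension_signs_def A_def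
      by (rule suspension_sign_condition[OF J, symmetric])
    show ?thesis
      unfolding signs
    proof
      assume fan: "fan_injective ?L w"
      show "\<forall>s t. A s t"
      proof (intro allI)
        fix s t
        define z where "z = (\<lambda>v. if v = a then s else if v = b then t else
          if v \<in> range \<beta> then - s * w a $ inv \<beta> v - t * w b $ inv \<beta> v else 0)"
        have za: "z a = s" and zb: "z b = t" by (auto simp: z_def a_def b_def)
        have z\<beta>: "z (\<beta> j) = - s * w a $ j - t * w b $ j" for j
          using notin inj unfolding z_def by (auto simp: image_iff)
        have "{v. 0 < z v} \<subseteq> ?V" "{v. z v < 0} \<subseteq> ?V"
          unfolding V by (auto simp: z_def split: if_splits)
        moreover have "(\<Sum>v\<in>?V. z v *\<^sub>R w v) = 0"
          unfolding sum_V[OF w] by (simp add: z\<beta> za zb)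
        ultimately have "{v. 0 < z v} \<notin> ?L \<or> {v. z v < 0} \<notin> ?L \<or> z = (\<lambda>_. 0)"
          using fan unfolding fan_injective_def by blast
        then have "(0 < z (\<beta> i0) \<and> 0 < z a) \<or> (z (\<beta> i0) < 0 \<and> z a < 0) \<or>
            (0 < z b \<and> (\<forall>j\<in>J. 0 < z (\<beta> j))) \<or> (z b < 0 \<and> (\<forall>j\<in>J. z (\<beta> j) < 0)) \<or> (z a = 0 \<and> z b = 0)"
          unfolding mem_L using \<open>{v. 0 < z v} \<subseteq> ?V\<close> \<open>{v. z v < 0} \<subseteq> ?V\<close> by auto
        then show "A s t"
          unfolding za zb z\<beta> A_eq .
      qed
    next
      assume A: "\<forall>s t. A s t"
      show "fan_injective ?L w"
        unfolding fan_injective_def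
      proof (intro allI impI)
        fix z :: "nat + nat \<Rightarrow> real"
        assume P: "{v. 0 < z v} \<in> ?L" and N: "{v. z v < 0} \<in> ?L" and "(\<Sum>v\<in>?V. z v *\<^sub>R w v) = 0"
        then have z: "z (\<beta> j) = - z a * w a $ j - z b * w b $ j" for j
          unfolding sum_V[OF w] by blast
        have "A (z a) (z b)" using A by blast
        then have "(0 < z (\<beta> i0) \<and> 0 < z a) \<or> (z (\<beta> i0) < 0 \<and> z a < 0) \<or>
            (0 < z b \<and> (\<forall>j\<in>J. 0 < z (\<beta> j))) \<or> (z b < 0 \<and> (\<forall>j\<in>J. z (\<beta> j) < 0)) \<or> (z a = 0 \<and> z b = 0)"
          unfolding A_eq z .
        then have zab: "z a = 0" "z b = 0"
          using P N unfolding mem_L by auto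
        then have "z (\<beta> j) = 0" for j using z by simp
        then have "z v = 0" if "v \<in> ?V" for v
          using that zab unfolding V by auto
        moreover have "z v = 0" if "v \<notin> ?V" for v
        proof (rule ccontr)
          assume "z v \<noteq> 0"
          then have "v \<in> {v. 0 < z v} \<union> {v. z v < 0}" by auto
          then show False using P N that unfolding mem_L by auto
        qed
        ultimately show "z = (\<lambda>_. 0)" by auto
      qed
    qed
  qed
  define N where "N = {w \<in> ?V \<rightarrow>\<^sub>E UNIV. fan_injective ?L w \<and> (\<forall>j. w (\<beta> j) = (axis j 1 :: real ^ 'd))}"
  define \<tau> :: "nat + nat \<Rightarrow> real ^ 'd" where "\<tau> = (\<lambda>v. if v = a then - axis i0 1
     else if v = b then (\<chi> j. if j = i0 then 0 else - 1) else axis (inv \<beta> v) 1)"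
  have \<tau>: "\<tau> a = - axis i0 1" "\<tau> b = (\<chi> j. if j = i0 then 0 else - 1)" "\<tau> (\<beta> j) = axis j 1" for j
    using notin inj ab by (auto simp: \<tau>_def image_iff)
  have \<beta>V: "\<beta> j \<in> ?V" "a \<in> ?V" "b \<in> ?V" for j unfolding V by auto
  have N: "w \<in> N \<longleftrightarrow> w \<in> ?V \<rightarrow>\<^sub>E UNIV \<and> signs w \<and> (\<forall>j. w (\<beta> j) = axis j 1)" for w
    unfolding N_def using fan_iff[of w] by blast
  have "contractible_space (subtopology (product_topology (\<lambda>_. euclidean) ?V) N)"
  proof (rule contractible_subset_of_product[where h = "\<lambda>v t x. (1 - t) *\<^sub>R x + t *\<^sub>R \<tau> v" and a = \<tau>])
    show "N \<subseteq> ?V \<rightarrow>\<^sub>E UNIV" unfolding N_def by blast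
    fix t :: real and w assume t: "0 \<le> t" "t \<le> 1" and w: "w \<in> N"
    let ?w = "\<lambda>v\<in>?V. (1 - t) *\<^sub>R w v + t *\<^sub>R \<tau> v"
    have "signs ?w \<longleftrightarrow> suspension_signs ((1 - t) * (- w a $ i0) + t) ((1 - t) * w b $ i0)
        (\<lambda>j. (1 - t) * w a $ j) (\<lambda>j. (1 - t) * (- w b $ j) + t) J"
      unfolding signs_def suspension_signs_def using UNIV(2) \<beta>V(2,3)
      by (auto simp: \<tau> axis_def algebra_simps split: if_splits)
    then have "signs ?w"
      using suspension_signs_star_shaped[OF _ t] w unfolding N signs_def by blast
    moreover have "?w (\<beta> j) = axis j 1" for j
      using w \<beta>V(1) unfolding N by (simp add: \<tau> flip: scaleR_left.add)
    ultimately show "?w \<in> N" unfolding N by auto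
  qed (auto simp: case_prod_unfold intro!: continuous_intros)
  moreover have "restrict \<tau> ?V \<in> N"
    unfolding N signs_def suspension_signs_def using \<beta>V UNIV(2) by (auto simp: \<tau> axis_def)
  ultimately show ?thesis
    unfolding N_def
    by (intro flattening_space_homotopy_equivalent_orthogonal_group[OF finite_complex_suspended_boundary inj \<beta>L])
       auto
qed

section \<open>Simplicial circles are cycles\<close>

definition underlying_set :: "'v set set \<Rightarrow> ('v \<Rightarrow> real) set" where
  "underlying_set K = (\<Union>s\<in>K. geometric_simplex s)"

lemma nsphere_1_homeomorphic_circle:
  "nsphere 1 homeomorphic_space top_of_set (sphere (0::complex) 1)"
proof -
  let ?S = "{x :: nat \<Rightarrow> real. (\<Sum>i\<le>1. (x i)\<^sup>2) = 1 \<and> (\<forall>i\<ge>2. x i = 0)}"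
  have "nsphere 1 = top_of_set ?S"
    unfolding nsphere by (simp add: euclidean_product_topology Suc_le_eq numeral_2_eq_2 Collect_conj_eq)
  moreover have "homeomorphic_maps (top_of_set ?S) (top_of_set (sphere (0::complex) 1))
     (\<lambda>x. of_real (x 0) + \<i> * of_real (x 1)) (\<lambda>z i. if i = 0 then Re z else if i = 1 then Im z else 0)"
    unfolding homeomorphic_maps_def
  proof (intro conjI ballI)
    show "continuous_map (top_of_set ?S) (top_of_set (sphere (0::complex) 1))
        (\<lambda>x. of_real (x 0) + \<i> * of_real (x 1))"
      by (auto simp: cmod_def intro!: continuous_intros continuous_on_coordinate)
    show "continuous_map (top_of_set (sphere (0::complex) 1)) (top_of_set ?S)
        (\<lambda>z i. if i = 0 then Re z else if i = 1 then Im z else 0)"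
    proof -
      have "continuous_on (sphere (0::complex) 1) (\<lambda>z i::nat. if i = 0 then Re z else if i = 1 then Im z else 0)"
      proof (rule continuous_on_coordinatewise_then_product)
        fix i :: nat
        show "continuous_on (sphere (0::complex) 1) (\<lambda>z. if i = 0 then Re z else if i = 1 then Im z else 0)"
          by (cases "i = 0"; cases "i = 1") (auto intro!: continuous_intros)
      qed
      then show ?thesis by (auto simp: cmod_def)
    qed
    fix x assume "x \<in> topspace (top_of_set ?S)"
    then show "(\<lambda>i. if i = 0 then Re (of_real (x 0) + \<i> * of_real (x 1))
        else if i = 1 then Im (of_real (x 0) + \<i> * of_real (x 1)) else 0) = x"
      by (auto simp: fun_eq_iff)
  next
    fix z assume "z \<in> topspace (top_of_set (sphere (0::complex) 1))"
    show "of_real ((\<lambda>i. if i = 0 then Re z else if i = 1 then Im z else 0) (0::nat)) +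
        \<i> * of_real ((\<lambda>i. if i = 0 then Re z else if i = 1 then Im z else 0) (1::nat)) = z"
      by (simp add: complex_eq_iff)
  qed
  ultimately show ?thesis unfolding homeomorphic_space_def by auto
qed

lemma simplicial_circle_homeomorphic:
  assumes "simplicial_sphere 1 L"
  shows "underlying_set L homeomorphic sphere (0::complex) 1"
proof -
  have "top_of_set (underlying_set L) homeomorphic_space top_of_set (sphere (0::complex) 1)"
    using assms nsphere_1_homeomorphic_circle homeomorphic_space_trans
    unfolding simplicial_sphere_def realization_top_of_set underlying_set_def by blast
  then obtain f g where fg: "homeomorphic_maps (top_of_set (underlying_set L)) (top_of_set (sphere (0::complex) 1)) f g"
    unfolding homeomorphic_space_def by blast
  have "homeomorphism (underlying_set L) (sphere (0::complex) 1) f g"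
    by (rule homeomorphismI) (use fg in \<open>auto simp: homeomorphic_maps_def Pi_iff\<close>)
  then show ?thesis unfolding homeomorphic_def by blast
qed

text \<open>
  The point \<open>p\<close> is allowed to lie outside \<open>X\<close>, so that connectedness of \<open>X\<close> itself is included.
\<close>

lemma connected_punctured_circle:
  fixes X :: "'a::topological_space set"
  assumes "X homeomorphic sphere (0::complex) 1"
  shows "connected (X - {p})"
proof -
  obtain f g where fg: "homeomorphism X (sphere (0::complex) 1) f g"
    using assms unfolding homeomorphic_def by blast
  show ?thesis
  proof (cases "p \<in> X")
    case True
    define q where "q = f p"
    have q: "norm q = 1" using fg True unfolding q_def homeomorphism_def by auto
    have "sphere 0 1 - {q} = (\<lambda>t. q * cis t) ` {0<..<2 * pi}"
    proof (intro set_eqI iffI)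
      fix z assume z: "z \<in> sphere 0 1 - {q}"
      define t where "t = Arg2pi (z / q)"
      have "norm (z / q) = 1" using z q by (simp add: norm_divide)
      then have "z / q = cis t"
        using complex_norm_eq_1_exp[of "z / q"] by (simp add: t_def cis_conv_exp)
      then have zq: "z = q * cis t" using q by (auto simp: divide_eq_eq mult.commute split: if_splits)
      moreover have "t \<noteq> 0" using zq z by auto
      ultimately show "z \<in> (\<lambda>t. q * cis t) ` {0<..<2 * pi}"
        using Arg2pi[of "z / q"] by (auto simp: t_def less_le)
    next
      fix z assume "z \<in> (\<lambda>t. q * cis t) ` {0<..<2 * pi}"
      then obtain t where t: "z = q * cis t" "0 < t" "t < 2 * pi"
        using greaterThanLessThan_iff by blast
      have "cis t \<noteq> 1"
      proof
        assume "cis t = 1"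
        then have "cos t = 1" by (simp add: complex_eq_iff)
        then obtain n :: int where "t = of_int n * 2 * pi" unfolding cos_one_2pi_int by auto
        then have "0 < n" "n < 1" using t by (auto simp: zero_less_mult_iff)
        then show False by simp
      qed
      then show "z \<in> sphere 0 1 - {q}" using t q by (auto simp: norm_mult)
    qed
    then have "connected (sphere 0 1 - {q})"
      by (auto intro!: connected_continuous_image continuous_intros)
    moreover have "continuous_on (sphere 0 1 - {q}) g"
      using fg unfolding homeomorphism_def by (auto intro: continuous_on_subset)
    moreover have "g ` (sphere 0 1 - {q}) = X - {p}"
    proof -
      have "g ` (sphere 0 1 - {q}) = g ` sphere 0 1 - g ` {q}"
        using fg True unfolding homeomorphism_def q_def
        by (intro inj_on_image_set_diff[of _ "sphere 0 1"] inj_on_inverseI[of _ f]) auto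
      then show ?thesis using fg True unfolding homeomorphism_def q_def by auto
    qed
    ultimately show ?thesis using connected_continuous_image by metis
  next
    case False
    have "connected (g ` sphere 0 1)"
      using fg unfolding homeomorphism_def
      by (intro connected_continuous_image) (auto intro: connected_sphere)
    then show ?thesis using fg False unfolding homeomorphism_def by auto
  qed
qed

lemma real_intervals_share:
  fixes A B :: "real set"
  assumes "connected A" "connected B" "p \<in> A" "p \<in> B" "a \<in> A" "b \<in> B"
    and "(p < a \<and> p < b) \<or> (a < p \<and> b < p)"
  shows "\<exists>x\<in>A \<inter> B. x \<noteq> p"
  using assms(7)
proof
  assume "p < a \<and> p < b"
  then have "min a b \<in> A" "min a b \<in> B" "min a b \<noteq> p"
    using connectedD_interval[OF assms(1), of p a "min a b"]
      connectedD_interval[OF assms(2), of p b "min a b"] assms by auto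
  then show ?thesis by blast
next
  assume "a < p \<and> b < p"
  then have "max a b \<in> A" "max a b \<in> B" "max a b \<noteq> p"
    using connectedD_interval[OF assms(1), of a p "max a b"]
      connectedD_interval[OF assms(2), of b p "max a b"] assms by auto
  then show ?thesis by blast
qed

text \<open>
  Away from \<open>q\<close> the argument, measured from \<open>q\<close>, embeds the circle into the line. There, three connected
  sets through a point would be three nondegenerate intervals, two of which extend to the same side of
  the point and hence overlap.
\<close>

lemma no_triod_in_circle:
  fixes X :: "'a::topological_space set" and A :: "'i \<Rightarrow> 'a set"
  assumes X: "X homeomorphic sphere (0::complex) 1"
    and A: "\<And>i. i \<in> I \<Longrightarrow> connected (A i)" "\<And>i. i \<in> I \<Longrightarrow> A i \<subseteq> X - {q}"
      "\<And>i. i \<in> I \<Longrightarrow> p \<in> A i" "\<And>i. i \<in> I \<Longrightarrow> A i \<noteq> {p}"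
    and meet: "\<And>i j. i \<in> I \<Longrightarrow> j \<in> I \<Longrightarrow> i \<noteq> j \<Longrightarrow> A i \<inter> A j \<subseteq> {p}"
    and q: "q \<in> X" and I: "I = {i, j, k}" "i \<noteq> j" "i \<noteq> k" "j \<noteq> k"
  shows False
proof -
  obtain f g where fg: "homeomorphism X (sphere (0::complex) 1) f g"
    using X unfolding homeomorphic_def by blast
  \<comment> \<open>the argument jumps only on the positive real axis, which is met only at \<open>q\<close>\<close>
  define h where "h = (\<lambda>x. Arg2pi (f x / f q))"
  have fX: "norm (f x) = 1" if "x \<in> X" for x using fg that unfolding homeomorphism_def by auto
  have h: "f x = f q * cis (h x)" if "x \<in> X" for x
  proof -
    have "norm (f x / f q) = 1" using fX[OF that] fX[OF q] by (simp add: norm_divide)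
    then have "f x / f q = cis (h x)"
      using complex_norm_eq_1_exp[of "f x / f q"] by (simp add: h_def cis_conv_exp)
    then show ?thesis using fX[OF q] by (auto simp: divide_eq_eq mult.commute split: if_splits)
  qed
  have inj: "inj_on h X"
    using fg h unfolding homeomorphism_def by (metis inj_onI)
  have "continuous_on (X - {q}) h"
    unfolding h_def
  proof (rule continuous_on_compose2[of "- \<real>\<^sub>\<ge>\<^sub>0" Arg2pi])
    show "continuous_on (- \<real>\<^sub>\<ge>\<^sub>0) Arg2pi"
      using continuous_at_Arg2pi by (auto simp: continuous_on_eq_continuous_within continuous_at_imp_continuous_within)
    show "continuous_on (X - {q}) (\<lambda>x. f x / f q)"
      using fg fX[OF q] unfolding homeomorphism_def
      by (intro continuous_intros) (auto intro: continuous_on_subset)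
    show "(\<lambda>x. f x / f q) ` (X - {q}) \<subseteq> - \<real>\<^sub>\<ge>\<^sub>0"
    proof clarify
      fix x assume x: "x \<in> X" "x \<noteq> q" and "f x / f q \<in> \<real>\<^sub>\<ge>\<^sub>0"
      then obtain r where r: "f x / f q = of_real r" "0 \<le> r" by (auto elim: nonneg_Reals_cases)
      have "norm (f x / f q) = 1" using fX[OF x(1)] fX[OF q] by (simp add: norm_divide)
      then have "r = 1" using r by (metis abs_of_nonneg norm_of_real)
      then have "f x = f q" using r fX[OF q] by (auto simp: divide_eq_eq split: if_splits)
      then show False using x q fg unfolding homeomorphism_def by metis
    qed
  qed
  then have conn: "connected (h ` A i)" if "i \<in> I" for i
    using A(1,2)[OF that] by (intro connected_continuous_image) (auto intro: continuous_on_subset)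
  have "\<exists>a\<in>A i. h a \<noteq> h p" if i: "i \<in> I" for i
  proof -
    obtain a where "a \<in> A i" "a \<noteq> p" using A(3,4)[OF i] by auto
    then show ?thesis using inj A(2,3)[OF i] by (auto simp: inj_on_def)
  qed
  then obtain a where a: "a i \<in> A i" "h (a i) \<noteq> h p" if "i \<in> I" for i by metis
  have False if "l \<in> I" "n \<in> I" "l \<noteq> n"
    and side: "(h p < h (a l) \<and> h p < h (a n)) \<or> (h (a l) < h p \<and> h (a n) < h p)" for l n
  proof -
    have "\<exists>x\<in>h ` A l \<inter> h ` A n. x \<noteq> h p"
      using real_intervals_share[OF conn[OF that(1)] conn[OF that(2)], of "h p" "h (a l)" "h (a n)"]
        A(3)[OF that(1)] A(3)[OF that(2)] a(1)[OF that(1)] a(1)[OF that(2)] side by blast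
    then obtain x y where xy: "x \<in> A l" "y \<in> A n" "h x = h y" "h x \<noteq> h p" by auto
    then have "x = y" using inj A(2)[OF that(1)] A(2)[OF that(2)] by (auto simp: inj_on_def)
    then show False using meet[OF that(1-3)] xy by auto
  qed
  from this[of i j] this[of i k] this[of j k] show False
    using a(2)[of i] a(2)[of j] a(2)[of k] I by (auto simp: linorder_neq_iff)
qed

lemma vertex_point_in_simplex: "finite s \<Longrightarrow> p \<in> s \<Longrightarrow> vertex_point p \<in> geometric_simplex s"
  by (auto simp: geometric_simplex_def vertex_point_def)

lemma geometric_simplex_convex:
  assumes "x \<in> geometric_simplex s" "y \<in> geometric_simplex s" "0 \<le> t" "t \<le> 1"
  shows "(\<lambda>v. (1 - t) * x v + t * y v) \<in> geometric_simplex s"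
  using assms by (auto simp: geometric_simplex_def sum.distrib simp flip: sum_distrib_left)

lemma underlying_setE:
  assumes "finite_complex L" "x \<in> underlying_set L" "x p \<noteq> 0"
  obtains s where "s \<in> L" "finite s" "x \<in> geometric_simplex s" "p \<in> s"
proof -
  obtain s where s: "s \<in> L" "x \<in> geometric_simplex s"
    using assms(2) unfolding underlying_set_def by blast
  moreover have "p \<in> s" using s(2) assms(3) by (auto simp: geometric_simplex_def)
  ultimately show thesis using that finite_complex_simplex[OF assms(1)] by blast
qed

text \<open>
  The level set \<open>x p = 1 / 2\<close> is a copy of the link of \<open>p\<close>. Three of its points, joined to \<open>p\<close> by segments,
  would give a triod.
\<close>

lemma circle_level_set_at_most_two:
  assumes L: "finite_complex L" and X: "underlying_set L homeomorphic sphere (0::complex) 1"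
    and I: "I = {x1, x2, x3}" "x1 \<noteq> x2" "x1 \<noteq> x3" "x2 \<noteq> x3"
    and half: "\<And>x. x \<in> I \<Longrightarrow> x \<in> underlying_set L \<and> x p = 1 / 2"
  shows False
proof -
  \<comment> \<open>the arms of the triod, and a point of the complex beyond the end of the first arm\<close>
  define A where "A = (\<lambda>x. (\<lambda>t v. (1 - t) * vertex_point p v + t * x v) ` {0..1::real})"
  define q where "q = (\<lambda>v. 2 * x1 v - vertex_point p v)"
  have q: "q \<in> underlying_set L" "q p = 0"
  proof -
    obtain s where s: "s \<in> L" "finite s" "x1 \<in> geometric_simplex s" "p \<in> s"
      using underlying_setE[OF L, of x1 p] half[of x1] I by auto
    have "(\<Sum>v\<in>s. vertex_point p v) = (1::real)" "(\<Sum>v\<in>s. x1 v) = 1"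
      using s vertex_point_in_simplex[OF s(2,4)] by (auto simp: geometric_simplex_def)
    then have "(\<Sum>v\<in>s. q v) = 1"
      by (simp add: q_def sum_subtractf flip: sum_distrib_left)
    moreover have "0 \<le> q v" "v \<notin> s \<Longrightarrow> q v = 0" for v
      using s half[of x1] I by (auto simp: q_def vertex_point_def geometric_simplex_def)
    ultimately show "q \<in> underlying_set L" using s(1) by (auto simp: underlying_set_def geometric_simplex_def)
    show "q p = 0" using half[of x1] I by (simp add: q_def vertex_point_def)
  qed
  show False
  proof (rule no_triod_in_circle[where I = I and A = A and q = q and p = "vertex_point p"
        and i = x1 and j = x2 and k = x3, OF X])
    fix x assume x: "x \<in> I"
    show "connected (A x)"
      unfolding A_def
      by (intro connected_continuous_image continuous_on_coordinatewise_then_product continuous_intros)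
         auto
    show "vertex_point p \<in> A x"
      unfolding A_def by (rule image_eqI[of _ _ 0]) auto
    have "x \<in> A x"
      unfolding A_def by (rule image_eqI[of _ _ 1]) auto
    moreover have "x \<noteq> vertex_point p"
      using half[OF x] by (auto simp: vertex_point_def)
    ultimately show "A x \<noteq> {vertex_point p}" by blast
    obtain s where s: "s \<in> L" "finite s" "x \<in> geometric_simplex s" "p \<in> s"
      using underlying_setE[OF L, of x p] half[OF x] by auto
    show "A x \<subseteq> underlying_set L - {q}"
    proof
      fix y assume "y \<in> A x"
      then obtain t where t: "0 \<le> t" "t \<le> 1" "y = (\<lambda>v. (1 - t) * vertex_point p v + t * x v)"
        unfolding A_def by auto
      have "y \<in> geometric_simplex s"
        using geometric_simplex_convex[OF vertex_point_in_simplex[OF s(2,4)] s(3) t(1,2)] t(3) by simp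
      moreover have "y p = 1 - t / 2"
        using half[OF x] by (simp add: t(3) vertex_point_def field_simps)
      ultimately show "y \<in> underlying_set L - {q}"
        using s(1) t q(2) by (auto simp: underlying_set_def)
    qed
  next
    fix x y assume x: "x \<in> I" and y: "y \<in> I" and ne: "x \<noteq> y"
    show "A x \<inter> A y \<subseteq> {vertex_point p}"
    proof
      fix z assume "z \<in> A x \<inter> A y"
      then obtain t t' where t: "z = (\<lambda>v. (1 - t) * vertex_point p v + t * x v)"
          "z = (\<lambda>v. (1 - t') * vertex_point p v + t' * y v)"
        unfolding A_def by blast
      have "z p = 1 - t / 2"
        unfolding t(1) using half[OF x] by (simp add: vertex_point_def field_simps)
      moreover have "z p = 1 - t' / 2"
        unfolding t(2) using half[OF y] by (simp add: vertex_point_def field_simps)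
      ultimately have "t = t'" by simp
      then have "t * x v = t * y v" for v
        using fun_cong[OF t(1), of v] fun_cong[OF t(2), of v] by auto
      then have "t = 0" using ne by (auto simp: fun_eq_iff)
      then show "z \<in> {vertex_point p}" using t(1) by simp
    qed
  qed (use q I in auto)
qed

lemma circle_not_singleton:
  fixes X :: "'a::topological_space set"
  assumes "X homeomorphic sphere (0::complex) 1"
  shows "\<exists>x\<in>X. x \<noteq> a"
proof (rule ccontr)
  assume "\<not> (\<exists>x\<in>X. x \<noteq> a)"
  then have X: "X \<subseteq> {a}" by blast
  obtain f g where "homeomorphism X (sphere (0::complex) 1) f g"
    using assms unfolding homeomorphic_def by blast
  then have "sphere (0::complex) 1 \<subseteq> {f a}" using X unfolding homeomorphism_def by blast
  moreover have "1 \<in> sphere (0::complex) 1" "-1 \<in> sphere (0::complex) 1" by simp_all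
  ultimately have "1 = f a" "-1 = f a" by blast+
  then show False by (metis one_neq_neg_one)
qed

text \<open>
  The level set separates \<open>p\<close> from the part of the complex away from \<open>p\<close>, whereas a circle stays
  connected after the removal of a point.
\<close>

lemma circle_level_set_at_least_two:
  assumes L: "finite_complex L" and X: "underlying_set L homeomorphic sphere (0::complex) 1"
    and p: "p \<in> vertices L"
  shows "\<exists>x\<in>underlying_set L. x p = 1 / 2 \<and> x \<noteq> m"
proof (rule ccontr)
  assume "\<not> (\<exists>x\<in>underlying_set L. x p = 1 / 2 \<and> x \<noteq> m)"
  then have level: "{x \<in> underlying_set L. x p = 1 / 2} \<subseteq> {m}" by blast
  let ?M = "{x \<in> underlying_set L. x p = 1 / 2}"
  \<comment> \<open>if the level set is empty, the zero function serves as a removed point that was not there\<close>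
  have "(\<lambda>_. 0) \<notin> underlying_set L" by (auto simp: underlying_set_def geometric_simplex_def)
  then have "underlying_set L - ?M = underlying_set L - {if ?M = {} then (\<lambda>_. 0) else m}"
    using level by auto
  then have conn: "connected (underlying_set L - ?M)"
    using connected_punctured_circle[OF X] by simp
  then have conn: "connected ((\<lambda>x. x p) ` (underlying_set L - ?M))"
    by (intro connected_continuous_image continuous_on_coordinate)
  have vertex: "vertex_point v \<in> underlying_set L" if "{v} \<in> L" for v
    using that vertex_point_in_simplex[of "{v}" v] by (auto simp: underlying_set_def)
  have "vertex_point p \<in> underlying_set L - ?M"
    using p vertex by (auto simp: vertices_def vertex_point_def)
  then have one: "1 \<in> (\<lambda>x. x p) ` (underlying_set L - ?M)"
    by (rule rev_image_eqI) (simp add: vertex_point_def)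
  obtain x where x: "x \<in> underlying_set L" "x \<noteq> vertex_point p"
    using circle_not_singleton[OF X] by blast
  then obtain s where s: "s \<in> L" "x \<in> geometric_simplex s" by (auto simp: underlying_set_def)
  have "\<not> s \<subseteq> {p}"
  proof
    assume "s \<subseteq> {p}"
    then have "s = {p} \<or> s = {}" by blast
    then have "x = vertex_point p"
      using s(2) by (auto simp: geometric_simplex_def vertex_point_def fun_eq_iff)
    then show False using x(2) by simp
  qed
  then obtain v where v: "v \<in> s" "v \<noteq> p" by blast
  then have "{v} \<in> L" using finite_complex_subset[OF L s(1)] by simp
  then have "vertex_point v \<in> underlying_set L - ?M"
    using vertex v(2) by (auto simp: vertex_point_def)
  then have "0 \<in> (\<lambda>x. x p) ` (underlying_set L - ?M)"
    by (rule rev_image_eqI) (use v in \<open>simp add: vertex_point_def\<close>)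
  then have "1 / 2 \<in> (\<lambda>x. x p) ` (underlying_set L - ?M)"
    using connectedD_interval[OF conn _ one, of 0 "1 / 2"] by simp
  then show False by auto
qed

text \<open>
  The link of \<open>p\<close> has exactly two points, so it has two vertices and no edge.
\<close>

lemma vertex_link_in_simplicial_circle:
  assumes L: "finite_complex L" and X: "underlying_set L homeomorphic sphere (0::complex) 1"
    and p: "p \<in> vertices L"
  obtains a b where "a \<noteq> b" "a \<noteq> p" "b \<noteq> p" "{s \<in> L. p \<in> s} = {{p}, {p, a}, {p, b}}"
proof -
  define mid where "mid = (\<lambda>a v. if v = p \<or> v = a then 1 / 2 else 0 :: real)"
  have mid: "mid a \<in> underlying_set L \<and> mid a p = 1 / 2" if "{p, a} \<in> L" "a \<noteq> p" for a
    using that by (auto simp: underlying_set_def geometric_simplex_def mid_def intro!: bexI[of _ "{p, a}"])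
  have mid_inj: "mid a \<noteq> mid b" if "a \<noteq> b" "a \<noteq> p" "b \<noteq> p" for a b
    using that by (auto simp: mid_def fun_eq_iff)
  have face: "{p, a} \<in> L" if "s \<in> L" "p \<in> s" "a \<in> s" for s a
    using finite_complex_subset[OF L that(1)] that by simp
  obtain x where x: "x \<in> underlying_set L" "x p = 1 / 2"
    using circle_level_set_at_least_two[OF L X p] by blast
  obtain s where s: "s \<in> L" "finite s" "x \<in> geometric_simplex s" "p \<in> s"
    using underlying_setE[OF L x(1), of p] x(2) by auto
  have "s \<noteq> {p}" using s(3) x(2) by (auto simp: geometric_simplex_def)
  then obtain a where a: "a \<in> s" "a \<noteq> p" using s(4) by blast
  obtain y where y: "y \<in> underlying_set L" "y p = 1 / 2" "y \<noteq> mid a"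
    using circle_level_set_at_least_two[OF L X p] by blast
  obtain s' where s': "s' \<in> L" "finite s'" "y \<in> geometric_simplex s'" "p \<in> s'"
    using underlying_setE[OF L y(1), of p] y(2) by auto
  have "\<not> s' \<subseteq> {p, a}"
  proof
    assume "s' \<subseteq> {p, a}"
    then have "s' = {p} \<or> s' = {p, a}" using s'(4) by blast
    then have "y = mid a"
      using s'(3) y(2) a(2) by (auto simp: geometric_simplex_def mid_def fun_eq_iff)
    then show False using y(3) by simp
  qed
  then obtain b where b: "b \<in> s'" "b \<noteq> p" "b \<noteq> a" by blast
  have pa: "{p, a} \<in> L" and pb: "{p, b} \<in> L"
    using face[OF s(1,4) a(1)] face[OF s'(1,4) b(1)] by auto
  have only: "z = mid a \<or> z = mid b" if "z \<in> underlying_set L" "z p = 1 / 2" for z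
    using circle_level_set_at_most_two[OF L X refl, of "mid a" "mid b" z p]
      mid[OF pa a(2)] mid[OF pb b(2)] mid_inj[of a b] a b that by auto
  have nb: "c = a \<or> c = b" if "{p, c} \<in> L" "c \<noteq> p" for c
    using only[of "mid c"] mid[OF that] mid_inj that(2) a(2) b(2) by metis
  have no_triangle: "{p, a, b} \<notin> L"
  proof
    assume "{p, a, b} \<in> L"
    \<comment> \<open>a third point of the level set, between the other two\<close>
    define z where "z = (\<lambda>v. if v = p then 1 / 2 else if v = a \<or> v = b then 1 / 4 else 0 :: real)"
    have "z \<in> geometric_simplex {p, a, b}"
      using a b by (auto simp: geometric_simplex_def z_def)
    then have "z \<in> underlying_set L" using \<open>{p, a, b} \<in> L\<close> by (auto simp: underlying_set_def)
    then have "z = mid a \<or> z = mid b" by (intro only) (simp_all add: z_def)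
    then have "z a = mid a a \<or> z b = mid b b" by auto
    then show False using a b by (simp add: z_def mid_def)
  qed
  have "s = {p} \<or> s = {p, a} \<or> s = {p, b}" if "s \<in> L" "p \<in> s" for s
  proof -
    have "s \<subseteq> {p, a, b}" using nb face[OF that] by blast
    moreover have "\<not> {p, a, b} \<subseteq> s" using no_triangle finite_complex_subset[OF L that(1)] by blast
    ultimately show ?thesis using that(2) by blast
  qed
  then have "{s \<in> L. p \<in> s} = {{p}, {p, a}, {p, b}}"
    using pa pb p by (auto simp: vertices_def)
  then show thesis using that[of a b] a b by blast
qed

text \<open>
  The total weight on \<open>S\<close> is continuous and, by the closure condition, takes only the values \<open>0\<close> and \<open>1\<close>.
\<close>

lemma simplicial_circle_connected:
  assumes L: "finite_complex L" and X: "underlying_set L homeomorphic sphere (0::complex) 1"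
    and S: "S \<subseteq> vertices L" "S \<noteq> {}"
    and closed: "\<And>u v. u \<in> S \<Longrightarrow> {u, v} \<in> L \<Longrightarrow> v \<in> S"
  shows "S = vertices L"
proof (rule ccontr)
  assume "S \<noteq> vertices L"
  then obtain v where v: "v \<in> vertices L" "v \<notin> S" using S(1) by blast
  obtain u where u: "u \<in> S" using S(2) by blast
  let ?\<phi> = "\<lambda>x::'a \<Rightarrow> real. \<Sum>v\<in>S. x v"
  have fin: "finite S" using finite_vertices[OF L] S(1) finite_subset by blast
  have "(\<lambda>_. 0) \<notin> underlying_set L" by (auto simp: underlying_set_def geometric_simplex_def)
  then have "connected (underlying_set L)"
    using connected_punctured_circle[OF X, of "\<lambda>_. 0"] by simp
  then have "connected (?\<phi> ` underlying_set L)"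
    by (intro connected_continuous_image continuous_intros continuous_on_coordinate)
  moreover have vertex: "vertex_point w \<in> underlying_set L" if "w \<in> vertices L" for w
    using that vertex_point_in_simplex[of "{w}" w] by (auto simp: underlying_set_def vertices_def)
  have "0 \<in> ?\<phi> ` underlying_set L"
    using vertex[OF v(1)] by (rule rev_image_eqI) (use v(2) in \<open>auto simp: vertex_point_def intro!: sum.neutral\<close>)
  moreover have "1 \<in> ?\<phi> ` underlying_set L"
    by (rule rev_image_eqI[of "vertex_point u"]) (use u S(1) fin vertex in \<open>auto simp: vertex_point_def\<close>)
  ultimately have "1 / 2 \<in> ?\<phi> ` underlying_set L"
    using connectedD_interval[of "?\<phi> ` underlying_set L" 0 1 "1 / 2"] by simp
  then obtain x s where x: "?\<phi> x = 1 / 2" "s \<in> L" "x \<in> geometric_simplex s"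
    by (auto simp: underlying_set_def)
  have sum_Int: "?\<phi> x = (\<Sum>v\<in>S \<inter> s. x v)"
    using x(3) fin by (intro sum.mono_neutral_right) (auto simp: geometric_simplex_def)
  show False
  proof (cases "S \<inter> s = {}")
    case True
    then show False using sum_Int x(1) by simp
  next
    case False
    then obtain u where u: "u \<in> S" "u \<in> s" by blast
    have "s \<subseteq> S"
    proof
      fix w assume "w \<in> s"
      then show "w \<in> S" using closed[OF u(1), of w] finite_complex_subset[OF L x(2)] u(2) by simp
    qed
    then have "?\<phi> x = 1" using sum_Int x(3) by (simp add: Int_absorb1 geometric_simplex_def)
    then show False using x(1) by simp
  qed
qed

text \<open>
  A walk that never turns back is determined by its first step, so its first repetition can only be at its
  starting point: a repetition at a later vertex would give that vertex a third neighbour.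
\<close>

lemma closed_walk_in_two_regular_graph:
  fixes N :: "'v \<Rightarrow> 'v set"
  assumes V: "finite V" "v0 \<in> V" "\<And>u. u \<in> V \<Longrightarrow> N u \<subseteq> V"
    and two: "\<And>u. u \<in> V \<Longrightarrow> card (N u) = 2"
    and irrefl: "\<And>u. u \<in> V \<Longrightarrow> u \<notin> N u"
    and sym: "\<And>u v. u \<in> V \<Longrightarrow> v \<in> N u \<Longrightarrow> u \<in> N v"
  obtains c m where "3 \<le> m" "inj_on c {..<m}" "c m = c (0::nat)" "c ` {..<m} \<subseteq> V"
    "N (c 0) = {c 1, c (m - 1)}" "\<And>i. 0 < i \<Longrightarrow> i < m \<Longrightarrow> N (c i) = {c (i - 1), c (Suc i)}"
proof -
  have other: "\<exists>w. w \<in> N v \<and> w \<noteq> u" if v: "v \<in> V" for u v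
  proof -
    obtain x y where "N v = {x, y}" "x \<noteq> y" using two[OF v] by (auto simp: card_2_iff)
    then show ?thesis by (cases "x = u") auto
  qed
  obtain v1 where v1: "v1 \<in> N v0" using other[OF V(2)] by blast
  have "\<exists>d. \<forall>n. (fst (d n) \<in> V \<and> snd (d n) \<in> N (fst (d n))) \<and>
      (fst (d (Suc n)) = snd (d n) \<and> snd (d (Suc n)) \<noteq> fst (d n))"
  proof (rule dependent_nat_choice)
    show "\<exists>x. fst x \<in> V \<and> snd x \<in> N (fst x)"
      using v1 V(2) by (intro exI[of _ "(v0, v1)"]) simp
    fix x :: "'v \<times> 'v" assume "fst x \<in> V \<and> snd x \<in> N (fst x)"
    then have "snd x \<in> V" using V(3) by blast
    then obtain w where "w \<in> N (snd x)" "w \<noteq> fst x" using other by blast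
    then show "\<exists>y. (fst y \<in> V \<and> snd y \<in> N (fst y)) \<and> fst y = snd x \<and> snd y \<noteq> fst x"
      using \<open>snd x \<in> V\<close> by (intro exI[of _ "(snd x, w)"]) simp
  qed
  then obtain d where d: "\<And>n. fst (d n) \<in> V" "\<And>n. snd (d n) \<in> N (fst (d n))"
    "\<And>n. fst (d (Suc n)) = snd (d n)" "\<And>n. snd (d (Suc n)) \<noteq> fst (d n)" by blast
  define c where "c = (\<lambda>n. fst (d n))"
  have cV: "c n \<in> V" and step: "c (Suc n) \<in> N (c n)" and turn: "c (Suc (Suc n)) \<noteq> c n" for n
    using d(1,2,4)[of n] d(3)[of n] d(3)[of "Suc n"] by (auto simp: c_def)
  have prev: "c n \<in> N (c (Suc n))" for n using sym[OF cV step] .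
  have nb: "N (c (Suc n)) = {c n, c (Suc (Suc n))}" for n
  proof -
    have "{c n, c (Suc (Suc n))} \<subseteq> N (c (Suc n))" "card {c n, c (Suc (Suc n))} = 2"
      using prev step turn[of n] by auto
    then show ?thesis
      using two[OF cV] by (metis card.infinite card_subset_eq zero_neq_numeral)
  qed
  have "\<not> inj c" using cV V(1) by (metis finite_subset image_subsetI infinite_UNIV_nat finite_imageD)
  then obtain i j where "i < j" "c i = c j" unfolding inj_def by (metis linorder_neqE_nat)
  moreover have repeated: "c j \<in> c ` {..<j}" if "i < j" "c i = c j" for i j
    by (intro image_eqI[of _ _ i]) (use that in auto)
  ultimately have ex: "\<exists>j. c j \<in> c ` {..<j}" by blast
  define m where "m = (LEAST j. c j \<in> c ` {..<j})"
  have m: "c m \<in> c ` {..<m}" unfolding m_def by (rule LeastI_ex[OF ex])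
  have least: "c j \<notin> c ` {..<j}" if "j < m" for j using that not_less_Least unfolding m_def by blast
  have inj: "inj_on c {..<m}"
  proof (rule inj_onI)
    fix i j assume "i \<in> {..<m}" "j \<in> {..<m}" "c i = c j"
    then show "i = j"
      using least[of i] least[of j] repeated[of i j] repeated[of j i]
      by (cases i j rule: linorder_cases) auto
  qed
  obtain i where i: "i < m" "c m = c i" using m by auto
  have ne: "c (Suc n) \<noteq> c n" for n using irrefl[OF cV, of n] step[of n] by auto
  have m3: "Suc (Suc i) < m"
  proof -
    have "m \<noteq> Suc i" "m \<noteq> Suc (Suc i)" using i(2) ne[of i] turn[of i] by auto
    then show ?thesis using i(1) by simp
  qed
  have i0: "i = 0"
  proof (rule ccontr)
    assume "i \<noteq> 0"
    then obtain k where k: "i = Suc k" using not0_implies_Suc by blast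
    obtain l where l: "m = Suc l" using i(1) not0_implies_Suc by fastforce
    have "c l \<in> N (c i)" using prev[of l] i(2) l by simp
    then have "c l = c k \<or> c l = c (Suc i)" using nb[of k] k by auto
    then have "l = k \<or> l = Suc i" using inj_on_eq_iff[OF inj, of l k] inj_on_eq_iff[OF inj, of l "Suc i"] k l m3 by auto
    then show False using k l m3 by auto
  qed
  obtain l where l: "m = Suc l" using i(1) not0_implies_Suc by fastforce
  have "N (c 0) = {c 1, c l}"
  proof -
    have "c l \<in> N (c 0)" using prev[of l] i(2) l i0 by simp
    moreover have "c 1 \<noteq> c l" using inj_on_eq_iff[OF inj, of 1 l] l m3 i0 by auto
    ultimately have "{c 1, c l} \<subseteq> N (c 0)" "card {c 1, c l} = 2" using step[of 0] by auto
    then show ?thesis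
      using two[OF cV] by (metis card.infinite card_subset_eq zero_neq_numeral)
  qed
  moreover have "N (c i) = {c (i - 1), c (Suc i)}" if "0 < i" for i
    using nb[of "i - 1"] that by simp
  ultimately show thesis
    using that[of m c] inj i(2) i0 m3 cV l by auto
qed

theorem simplicial_circle_is_cycle:
  assumes "simplicial_sphere 1 L"
  obtains c m where "3 \<le> m" "inj_on c {..<m}" "c m = c (0::nat)" "vertices L = c ` {..<m}"
    "L = insert {} ((\<lambda>i. {c i}) ` {..<m} \<union> (\<lambda>i. {c i, c (Suc i)}) ` {..<m})"
proof -
  have L: "finite_complex L" using assms by (simp add: simplicial_sphere_def)
  have X: "underlying_set L homeomorphic sphere (0::complex) 1"
    by (rule simplicial_circle_homeomorphic[OF assms])
  define N where "N = (\<lambda>u. {v. v \<noteq> u \<and> {u, v} \<in> L})"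
  have link: "card (N u) = 2 \<and> (\<forall>s\<in>L. u \<in> s \<longrightarrow> s = {u} \<or> (\<exists>v\<in>N u. s = {u, v}))"
    if u: "u \<in> vertices L" for u
  proof -
    obtain a b where ab: "a \<noteq> b" "a \<noteq> u" "b \<noteq> u" "{s \<in> L. u \<in> s} = {{u}, {u, a}, {u, b}}"
      using vertex_link_in_simplicial_circle[OF L X u] .
    have "v \<in> N u \<longleftrightarrow> v = a \<or> v = b" for v
    proof -
      have "{u, v} \<in> L \<longleftrightarrow> {u, v} \<in> {s \<in> L. u \<in> s}" by simp
      then show ?thesis unfolding N_def ab(4) using ab(1-3) by (auto simp: doubleton_eq_iff)
    qed
    then have N: "N u = {a, b}" by auto
    moreover have "s = {u} \<or> (\<exists>v\<in>N u. s = {u, v})" if "s \<in> L" "u \<in> s" for s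
    proof -
      have "s \<in> {s \<in> L. u \<in> s}" using that by simp
      then show ?thesis unfolding ab(4) N by auto
    qed
    ultimately show ?thesis using ab(1) by simp
  qed
  obtain x where "x \<in> underlying_set L" using circle_not_singleton[OF X] by blast
  then obtain s where s: "s \<in> L" "x \<in> geometric_simplex s" by (auto simp: underlying_set_def)
  have "s \<noteq> {}" using s(2) by (auto simp: geometric_simplex_def)
  then obtain v0 where v0: "v0 \<in> vertices L" using simplex_subset_vertices[OF L s(1)] by blast
  have NV: "N u \<subseteq> vertices L" for u
    using simplex_subset_vertices[OF L] by (auto simp: N_def)
  obtain c m where c: "3 \<le> m" "inj_on c {..<m}" "c m = c (0::nat)" "c ` {..<m} \<subseteq> vertices L"
    "N (c 0) = {c 1, c (m - 1)}" "\<And>i. 0 < i \<Longrightarrow> i < m \<Longrightarrow> N (c i) = {c (i - 1), c (Suc i)}"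
  proof (rule closed_walk_in_two_regular_graph[OF finite_vertices[OF L] v0 NV])
    show "u \<notin> N u" for u by (simp add: N_def)
    show "u \<in> N v" if "v \<in> N u" for u v using that by (auto simp: N_def insert_commute)
    show "card (N u) = 2" if "u \<in> vertices L" for u using link[OF that] by blast
  qed blast
  have cS: "c (Suc i) \<in> c ` {..<m}" if "i < m" for i
    using that c(1,3) by (cases "Suc i = m") auto
  have V: "c ` {..<m} = vertices L"
  proof (rule simplicial_circle_connected[OF L X c(4)])
    show "c ` {..<m} \<noteq> {}" using c(1) by (simp add: lessThan_empty_iff)
    fix u v assume u: "u \<in> c ` {..<m}" and uv: "{u, v} \<in> L"
    show "v \<in> c ` {..<m}"
    proof (cases "u = v")
      case False
      then have "v \<in> N u" using uv by (simp add: N_def)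
      obtain i where i: "i < m" "u = c i" using u by auto
      then have "v = c (i - 1) \<or> v = c (Suc i) \<or> v = c 1 \<or> v = c (m - 1)"
        using \<open>v \<in> N u\<close> c(5,6) by (cases "i = 0") auto
      then show ?thesis using i c(1) cS[OF i(1)] by auto
    qed (use u in simp)
  qed
  have "L \<subseteq> insert {} ((\<lambda>i. {c i}) ` {..<m} \<union> (\<lambda>i. {c i, c (Suc i)}) ` {..<m})"
  proof
    fix s assume s: "s \<in> L"
    show "s \<in> insert {} ((\<lambda>i. {c i}) ` {..<m} \<union> (\<lambda>i. {c i, c (Suc i)}) ` {..<m})"
    proof (cases "s = {}")
      case False
      then obtain u where u: "u \<in> s" by blast
      then obtain i where i: "i < m" "u = c i"
        using simplex_subset_vertices[OF L s] V by auto
      have "c i \<in> vertices L" using V i by auto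
      then consider "s = {c i}" | v where "v \<in> N (c i)" "s = {c i, v}"
        using link s u i(2) by blast
      then show ?thesis
      proof cases
        case 2
        show ?thesis
        proof (cases "i = 0")
          case True
          then consider "v = c 1" | "v = c (m - 1)" using 2 c(5) by auto
          then show ?thesis
          proof cases
            case 1
            then have "s = {c 0, c (Suc 0)}" using 2 True by simp
            then show ?thesis using c(1) by auto
          next
            case n: 2
            have "c (Suc (m - 1)) = c 0" using c(1,3) by simp
            then have "s = {c (m - 1), c (Suc (m - 1))}" using 2 n True by auto
            moreover have "m - 1 < m" using c(1) by simp
            ultimately show ?thesis by blast
          qed
        next
          case False
          then consider "v = c (i - 1)" | "v = c (Suc i)" using 2 c(6) i(1) by auto
          then show ?thesis
          proof cases
            case 1
            have "s = {c (i - 1), c (Suc (i - 1))}" using 1 2 False by auto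
            moreover have "i - 1 < m" using i(1) by simp
            ultimately show ?thesis by blast
          next
            case n: 2
            then show ?thesis using 2 i(1) by blast
          qed
        qed
      qed (use i in blast)
    qed simp
  qed
  moreover have "{c i} \<in> L" "{c i, c (Suc i)} \<in> L" if i: "i < m" for i
  proof -
    have "c i \<in> vertices L" using V i by auto
    then show "{c i} \<in> L" by (simp add: vertices_def)
    have "c (Suc i) \<in> N (c i)" using c(5) c(6)[of i] i by (cases "i = 0") auto
    then show "{c i, c (Suc i)} \<in> L" by (simp add: N_def)
  qed
  then have "insert {} ((\<lambda>i. {c i}) ` {..<m} \<union> (\<lambda>i. {c i, c (Suc i)}) ` {..<m}) \<subseteq> L"
    using L by (auto simp: finite_complex_def)
  ultimately show thesis using that[of m c] c(1-3) V by blast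
qed

section \<open>Flattenings of a cycle\<close>

text \<open>
  The argument of the \<open>i\<close>-th vector; the vector with index \<open>m\<close> is the first one again, now reached after a
  full turn.
\<close>

definition ray_angle :: "nat \<Rightarrow> (nat \<Rightarrow> complex) \<Rightarrow> nat \<Rightarrow> real" where
  "ray_angle m Z i = (if i = m then 2 * pi else Arg2pi (Z i))"

definition winds_once :: "nat \<Rightarrow> (nat \<Rightarrow> complex) \<Rightarrow> bool" where
  "winds_once m Z \<longleftrightarrow> (\<forall>i<m. Z i \<noteq> 0 \<and> ray_angle m Z i < ray_angle m Z (Suc i) \<and>
     ray_angle m Z (Suc i) < ray_angle m Z i + pi)"

lemma complex_polar: "z = of_real (cmod z) * cis (Arg2pi z)"
  using Arg2pi_eq[of z] by (simp add: cis_conv_exp)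

lemma Arg2pi_polar:
  assumes "0 < r" "0 \<le> a" "a < 2 * pi"
  shows "Arg2pi (of_real r * cis a) = a"
  using assms by (intro Arg2pi_unique) (auto simp: cis_conv_exp)

text \<open>
  A positive combination of two rays less than a half turn apart points into the sector between them.
\<close>

lemma Arg2pi_sector:
  assumes a: "0 < a" and b: "0 \<le> b" and \<alpha>: "0 \<le> \<alpha>" and \<beta>: "\<alpha> < \<beta>" "\<beta> \<le> 2 * pi" "\<beta> < \<alpha> + pi"
  shows "of_real a * cis \<alpha> + of_real b * cis \<beta> \<noteq> 0"
    and "\<alpha> \<le> Arg2pi (of_real a * cis \<alpha> + of_real b * cis \<beta>)"
    and "Arg2pi (of_real a * cis \<alpha> + of_real b * cis \<beta>) < \<beta>"
proof -
  define \<gamma> where "\<gamma> = \<beta> - \<alpha>"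
  have \<gamma>: "0 < \<gamma>" "\<gamma> < pi" using \<beta> by (auto simp: \<gamma>_def)
  define \<zeta> where "\<zeta> = of_real a + of_real b * cis \<gamma>"
  define \<phi> where "\<phi> = Arg2pi \<zeta>"
  have sum: "of_real a * cis \<alpha> + of_real b * cis \<beta> = cis \<alpha> * \<zeta>"
    by (simp add: \<zeta>_def \<gamma>_def algebra_simps cis_mult)
  have \<zeta>: "\<zeta> = of_real (cmod \<zeta>) * cis \<phi>" unfolding \<phi>_def by (rule complex_polar)
  have sin: "cmod \<zeta> * sin (\<gamma> - \<phi>) = a * sin \<gamma>"
  proof -
    have "a + b * cos \<gamma> = cmod \<zeta> * cos \<phi>" "b * sin \<gamma> = cmod \<zeta> * sin \<phi>"
      using arg_cong[OF \<zeta>, of Re] arg_cong[OF \<zeta>, of Im] by (simp_all add: \<zeta>_def)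
    then have "cmod \<zeta> * sin (\<gamma> - \<phi>) = sin \<gamma> * (a + b * cos \<gamma>) - cos \<gamma> * (b * sin \<gamma>)"
      by (simp add: sin_diff algebra_simps)
    then show ?thesis by (simp add: algebra_simps)
  qed
  moreover have pos: "0 < a * sin \<gamma>" using a \<gamma> by (simp add: sin_gt_zero)
  ultimately have norm: "0 < cmod \<zeta>" and sin_pos: "0 < sin (\<gamma> - \<phi>)"
    using norm_ge_zero[of \<zeta>] by (metis mult_eq_0_iff less_le, metis zero_less_mult_pos mult_eq_0_iff less_le)
  have "0 \<le> Im \<zeta>" using b \<gamma> by (simp add: \<zeta>_def sin_ge_zero)
  then have "\<phi> \<le> pi" unfolding \<phi>_def by (simp add: Arg2pi_le_pi)
  have "0 \<le> \<phi>" unfolding \<phi>_def using Arg2pi by blast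
  have "\<phi> < \<gamma>"
  proof (rule ccontr)
    assume "\<not> \<phi> < \<gamma>"
    then have "0 \<le> sin (\<phi> - \<gamma>)" using \<open>\<phi> \<le> pi\<close> \<gamma> by (intro sin_ge_zero) auto
    then show False using sin_pos sin_minus[of "\<phi> - \<gamma>"] by simp
  qed
  have "cis \<alpha> * \<zeta> = of_real (cmod \<zeta>) * cis (\<alpha> + \<phi>)"
    by (subst \<zeta>) (simp add: cis_mult[symmetric])
  moreover have "Arg2pi (of_real (cmod \<zeta>) * cis (\<alpha> + \<phi>)) = \<alpha> + \<phi>"
    by (rule Arg2pi_polar)
       (use norm \<open>\<phi> < \<gamma>\<close> \<open>0 \<le> \<phi>\<close> \<alpha> \<beta> in \<open>auto simp: \<gamma>_def\<close>)
  ultimately have "Arg2pi (cis \<alpha> * \<zeta>) = \<alpha> + \<phi>" by simp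
  then show "\<alpha> \<le> Arg2pi (of_real a * cis \<alpha> + of_real b * cis \<beta>)"
    "Arg2pi (of_real a * cis \<alpha> + of_real b * cis \<beta>) < \<beta>"
    unfolding sum using \<open>\<phi> < \<gamma>\<close> \<open>0 \<le> \<phi>\<close> by (auto simp: \<gamma>_def)
  show "of_real a * cis \<alpha> + of_real b * cis \<beta> \<noteq> 0"
    unfolding sum using norm by auto
qed

text \<open>
  The vertex \<open>c 0\<close> is listed again as \<open>c m\<close>, so that the edge that closes the cycle is also of the form
  \<open>{c i, c (Suc i)}\<close> with \<open>i < m\<close>.
\<close>

locale cycle =
  fixes c :: "nat \<Rightarrow> 'v" and m :: nat and L :: "'v set set"
  assumes m: "3 \<le> m" and inj: "inj_on c {..<m}" and wrap: "c m = c 0"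
    and vertices_eq: "vertices L = c ` {..<m}"
    and L_eq: "L = insert {} ((\<lambda>i. {c i}) ` {..<m} \<union> (\<lambda>i. {c i, c (Suc i)}) ` {..<m})"
    and complex: "finite_complex L"
begin

lemma vertex_in_L: "i \<le> m \<Longrightarrow> {c i} \<in> L"
proof -
  assume "i \<le> m"
  then have "i < m \<or> i = m" by auto
  moreover have "{c i} \<in> L" if "i < m" for i using that by (subst L_eq) blast
  ultimately show ?thesis using wrap m by force
qed

lemma edge_in_L: "i < m \<Longrightarrow> {c i, c (Suc i)} \<in> L"
  by (subst L_eq) blast

lemma c_eq_iff: "i < m \<Longrightarrow> j < m \<Longrightarrow> c i = c j \<longleftrightarrow> i = j"
  using inj by (auto simp: inj_on_def)

lemma c_Suc_neq: "i < m \<Longrightarrow> c (Suc i) \<noteq> c i"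
  using c_eq_iff[of "Suc i" i] c_eq_iff[of 0 i] wrap m by (cases "Suc i = m") auto

lemma c_Suc_Suc_neq: "Suc i < m \<Longrightarrow> c (Suc (Suc i)) \<noteq> c i"
  using c_eq_iff[of "Suc (Suc i)" i] c_eq_iff[of 0 i] wrap m by (cases "Suc (Suc i) = m") auto

text \<open>
  No ray enters the sector of an edge that does not contain its vertex. Together with the independence of
  the vectors on a simplex, this is all that the analysis of cycles takes from injectivity.
\<close>

lemma ray_outside_sector:
  assumes fan: "fan_injective L W" and a: "{a} \<in> L" and bd: "{b, d} \<in> L" "a \<noteq> b" "a \<noteq> d" "b \<noteq> d"
    and nonneg: "0 < \<alpha>" "0 \<le> \<beta>" "0 \<le> \<gamma>"
  shows "\<alpha> *\<^sub>R W a \<noteq> \<beta> *\<^sub>R W b + \<gamma> *\<^sub>R W d"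
proof
  assume eq: "\<alpha> *\<^sub>R W a = \<beta> *\<^sub>R W b + \<gamma> *\<^sub>R W d"
  define z where "z = (\<lambda>v. if v = a then \<alpha> else if v = b then - \<beta> else if v = d then - \<gamma> else 0)"
  have z: "z a = \<alpha>" "z b = - \<beta>" "z d = - \<gamma>" using bd by (auto simp: z_def)
  have "{v. 0 < z v} \<in> L"
    by (rule finite_complex_subset[OF complex a]) (use nonneg in \<open>auto simp: z_def split: if_splits\<close>)
  moreover have "{v. z v < 0} \<in> L"
    by (rule finite_complex_subset[OF complex bd(1)]) (use nonneg in \<open>auto simp: z_def split: if_splits\<close>)
  moreover have "(\<Sum>v\<in>vertices L. z v *\<^sub>R W v) = (\<Sum>v\<in>{a, b, d}. z v *\<^sub>R W v)"
    using finite_vertices[OF complex] simplex_subset_vertices[OF complex a]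
      simplex_subset_vertices[OF complex bd(1)]
    by (intro sum.mono_neutral_right) (auto simp: z_def)
  then have "(\<Sum>v\<in>vertices L. z v *\<^sub>R W v) = 0"
    using bd eq z by (simp add: algebra_simps)
  ultimately have "z = (\<lambda>_. 0)" using fan unfolding fan_injective_def by blast
  then show False using z nonneg by simp
qed

text \<open>
  If the orientation changed from one edge to the next, the two sectors would lie on the same side of
  their common ray, and one of the outer rays would lie in the other sector.
\<close>

lemma cross_products_positive:
  fixes W :: "'v \<Rightarrow> complex"
  assumes fan: "fan_injective L W" and W: "W (c 0) = 1" "W (c 1) = \<i>" and i: "i < m"
  shows "W (c i) \<noteq> 0" "0 < Im (cnj (W (c i)) * W (c (Suc i)))"
proof -
  have nonzero: "W (c i) \<noteq> 0" if "i \<le> m" for i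
    using fan_injective_independent_on_simplex[OF complex fan vertex_in_L[OF that], of "\<lambda>_. 1" "c i"]
    by auto
  then show "W (c i) \<noteq> 0" using i by simp
  have cross: "Im (cnj (W (c i)) * W (c (Suc i))) \<noteq> 0" if i: "i < m" for i
  proof
    assume 0: "Im (cnj (W (c i)) * W (c (Suc i))) = 0"
    define \<rho> where "\<rho> = Re (cnj (W (c i)) * W (c (Suc i)))"
    have real: "cnj (W (c i)) * W (c (Suc i)) = of_real \<rho>"
      using 0 by (simp add: \<rho>_def complex_eq_iff)
    have "of_real ((cmod (W (c i)))\<^sup>2) * W (c (Suc i)) = W (c i) * (cnj (W (c i)) * W (c (Suc i)))"
      by (simp only: complex_norm_square mult.assoc)
    then have "of_real ((cmod (W (c i)))\<^sup>2) * W (c (Suc i)) = of_real \<rho> * W (c i)"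
      unfolding real by (simp only: mult.commute)
    then have "(- \<rho>) *\<^sub>R W (c i) + ((cmod (W (c i)))\<^sup>2) *\<^sub>R W (c (Suc i)) = 0"
      by (simp add: scaleR_conv_of_real)
    moreover define k where "k = (\<lambda>v. if v = c i then - \<rho> else (cmod (W (c i)))\<^sup>2)"
    ultimately have "(\<Sum>v\<in>{c i, c (Suc i)}. k v *\<^sub>R W v) = 0"
      using c_Suc_neq[OF i] by simp
    then have "k (c (Suc i)) = 0"
      by (rule fan_injective_independent_on_simplex[OF complex fan edge_in_L[OF i]]) simp
    then show False using c_Suc_neq[OF i] nonzero[of i] i by (simp add: k_def)
  qed
  show "0 < Im (cnj (W (c i)) * W (c (Suc i)))"
    using i
  proof (induction i)
    case 0
    then show ?case using W by simp
  next
    case (Suc i)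
    let ?a = "W (c i)" and ?b = "W (c (Suc i))" and ?d = "W (c (Suc (Suc i)))"
    have ab: "0 < Im (cnj ?a * ?b)" using Suc by simp
    show ?case
    proof (rule ccontr)
      assume "\<not> 0 < Im (cnj ?b * ?d)"
      then have bd: "0 < - Im (cnj ?b * ?d)" using cross[OF Suc.prems] by linarith
      \<comment> \<open>the linear relation between three plane vectors, with cross products as coefficients\<close>
      have rel: "Im (cnj ?b * ?d) *\<^sub>R ?a + Im (cnj ?d * ?a) *\<^sub>R ?b + Im (cnj ?a * ?b) *\<^sub>R ?d = 0"
        by (simp add: complex_eq_iff algebra_simps)
      have ne: "c i \<noteq> c (Suc i)" "c (Suc i) \<noteq> c (Suc (Suc i))" "c (Suc (Suc i)) \<noteq> c i"
        using c_Suc_neq[of i] c_Suc_neq[of "Suc i"] c_Suc_Suc_neq[of i] Suc.prems by auto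
      show False
      proof (cases "0 \<le> Im (cnj ?d * ?a)")
        case True
        have "(- Im (cnj ?b * ?d)) *\<^sub>R ?a = Im (cnj ?d * ?a) *\<^sub>R ?b + Im (cnj ?a * ?b) *\<^sub>R ?d"
          using rel by (simp add: algebra_simps add_eq_0_iff)
        then show False
          using ray_outside_sector[OF fan vertex_in_L[of i] edge_in_L[OF Suc.prems]] ne bd True ab Suc.prems
          by auto
      next
        case False
        have "Im (cnj ?a * ?b) *\<^sub>R ?d = (- Im (cnj ?b * ?d)) *\<^sub>R ?a + (- Im (cnj ?d * ?a)) *\<^sub>R ?b"
          using rel by (simp add: algebra_simps add_eq_0_iff)
        then show False
          using ray_outside_sector[OF fan vertex_in_L[of "Suc (Suc i)"] edge_in_L[of i]] ne bd False ab Suc.prems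
          by auto
      qed
    qed
  qed
qed

text \<open>
  Since all turns are counterclockwise by less than a half turn, the arguments increase unless a sector
  crosses the positive real axis. That axis is the ray of the first vector, so only the last sector
  can reach it.
\<close>

lemma fan_injective_imp_winds_once:
  fixes W :: "'v \<Rightarrow> complex"
  assumes fan: "fan_injective L W" and W: "W (c 0) = 1" "W (c 1) = \<i>"
  shows "winds_once m (\<lambda>i. W (c i))"
  unfolding winds_once_def
proof (intro allI impI)
  fix i assume i: "i < m"
  let ?Z = "\<lambda>i. W (c i)" and ?\<theta> = "ray_angle m (\<lambda>i. W (c i))"
  note pos = cross_products_positive[OF fan W]
  have polar: "W (c i) = of_real (cmod (W (c i))) * cis (?\<theta> i)" if "i \<le> m" for i
    using complex_polar[of "W (c i)"] that wrap W by (auto simp: ray_angle_def)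
  have sin: "0 < sin (?\<theta> (Suc i) - ?\<theta> i)"
  proof -
    define r s where "r = cmod (W (c i))" and "s = cmod (W (c (Suc i)))"
    have Z: "W (c i) = of_real r * cis (?\<theta> i)" "W (c (Suc i)) = of_real s * cis (?\<theta> (Suc i))"
      unfolding r_def s_def using polar i by simp_all
    have "Im (cnj (W (c i)) * W (c (Suc i))) = r * s * sin (?\<theta> (Suc i) - ?\<theta> i)"
      unfolding Z by (simp add: sin_diff algebra_simps)
    moreover have "0 \<le> r * s" by (simp add: r_def s_def)
    ultimately show ?thesis using pos(2)[OF i] by (metis zero_less_mult_pos mult_eq_0_iff less_le)
  qed
  have range: "0 \<le> ?\<theta> i" "?\<theta> i < 2 * pi" using Arg2pi i by (auto simp: ray_angle_def)
  have "0 < ?\<theta> (Suc i) - ?\<theta> i \<and> ?\<theta> (Suc i) - ?\<theta> i < pi"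
  proof (cases "Suc i = m")
    case True
    then have "?\<theta> (Suc i) = 2 * pi" by (simp add: ray_angle_def)
    moreover have "\<not> ?\<theta> i \<le> pi"
    proof -
      have "Im (W (c i)) < 0" using pos(2)[OF i] True wrap W by simp
      then show ?thesis using Arg2pi_le_pi[of "W (c i)"] i by (simp add: ray_angle_def)
    qed
    ultimately show ?thesis using range by auto
  next
    case False
    then have Si: "Suc i < m" using i by simp
    then have range': "0 \<le> ?\<theta> (Suc i)" "?\<theta> (Suc i) < 2 * pi" using Arg2pi by (auto simp: ray_angle_def)
    have "?\<theta> i < ?\<theta> (Suc i)"
    proof (rule ccontr)
      assume less: "\<not> ?\<theta> i < ?\<theta> (Suc i)"
      have "?\<theta> i - ?\<theta> (Suc i) > pi"
      proof (rule ccontr)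
        assume "\<not> ?\<theta> i - ?\<theta> (Suc i) > pi"
        then have "0 \<le> sin (?\<theta> i - ?\<theta> (Suc i))" using less by (intro sin_ge_zero) auto
        then show False using sin sin_minus[of "?\<theta> i - ?\<theta> (Suc i)"] by simp
      qed
      then have "?\<theta> i > pi" "?\<theta> (Suc i) < pi" using range range' by auto
      then have im: "Im (W (c i)) < 0" "0 \<le> Im (W (c (Suc i)))"
        using Arg2pi_le_pi[of "W (c i)"] Arg2pi_le_pi[of "W (c (Suc i))"] i Si
        by (auto simp: ray_angle_def not_le)
      then have "i \<noteq> 0" using W by (cases i) auto
      \<comment> \<open>the same relation, with the first vector \<open>1\<close> as the third one\<close>
      have "Im (cnj (W (c i)) * W (c (Suc i))) *\<^sub>R W (c 0) =
          Im (W (c (Suc i))) *\<^sub>R W (c i) + (- Im (W (c i))) *\<^sub>R W (c (Suc i))"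
        unfolding W by (simp add: complex_eq_iff algebra_simps)
      moreover have "Im (cnj (W (c i)) * W (c (Suc i))) *\<^sub>R W (c 0) \<noteq>
          Im (W (c (Suc i))) *\<^sub>R W (c i) + (- Im (W (c i))) *\<^sub>R W (c (Suc i))"
        using c_eq_iff[of 0 i] c_eq_iff[of 0 "Suc i"] c_Suc_neq[OF i] \<open>i \<noteq> 0\<close> Si i im pos(2)[OF i]
        by (intro ray_outside_sector[OF fan vertex_in_L edge_in_L]) auto
      ultimately show False by simp
    qed
    moreover have "?\<theta> (Suc i) - ?\<theta> i < pi"
    proof (rule ccontr)
      assume "\<not> ?\<theta> (Suc i) - ?\<theta> i < pi"
      then have "0 \<le> sin (?\<theta> (Suc i) - ?\<theta> i - pi)" using range range' by (intro sin_ge_zero) auto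
      then show False using sin by (simp add: sin_diff)
    qed
    ultimately show ?thesis by simp
  qed
  then show "?Z i \<noteq> 0 \<and> ?\<theta> i < ?\<theta> (Suc i) \<and> ?\<theta> (Suc i) < ?\<theta> i + pi"
    using pos(1)[OF i] by auto
qed

text \<open>
  The half-open sectors are disjoint, so the argument of a nonzero point of the cone complex tells which
  vertex \<open>c i\<close> carries positive weight. The positive and the negative part of a relation have the same
  image but disjoint supports.
\<close>

lemma winds_once_imp_fan_injective:
  fixes W :: "'v \<Rightarrow> complex"
  assumes winds: "winds_once m (\<lambda>i. W (c i))" and W: "W (c 0) = 1"
  shows "fan_injective L W"
proof -
  let ?\<theta> = "ray_angle m (\<lambda>i. W (c i))" and ?S = "\<lambda>f. \<Sum>v\<in>vertices L. f v *\<^sub>R W v"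
  have polar: "W (c i) = of_real (cmod (W (c i))) * cis (?\<theta> i)" if "i \<le> m" for i
    using complex_polar[of "W (c i)"] that wrap W by (auto simp: ray_angle_def)
  have turn: "?\<theta> i < ?\<theta> (Suc i)" "?\<theta> (Suc i) < ?\<theta> i + pi" "W (c i) \<noteq> 0" if "i < m" for i
    using winds that by (auto simp: winds_once_def)
  have mono: "?\<theta> i \<le> ?\<theta> j" if "i \<le> j" "j \<le> m" for i j
    using that
  proof (induction j rule: dec_induct)
    case (step n)
    then show ?case using turn(1)[of n] by simp
  qed simp
  have range: "0 \<le> ?\<theta> i" "?\<theta> i \<le> 2 * pi" for i
    using Arg2pi[of "W (c i)"] by (auto simp: ray_angle_def)
  have sector: "\<exists>i<m. 0 < f (c i) \<and> ?S f \<noteq> 0 \<and> ?\<theta> i \<le> Arg2pi (?S f) \<and> Arg2pi (?S f) < ?\<theta> (Suc i)"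
    if f: "\<And>v. 0 \<le> f v" "{v. 0 < f v} \<in> L" "{v. 0 < f v} \<noteq> {}" for f :: "'v \<Rightarrow> real"
  proof -
    obtain i where i: "i < m" "{v. 0 < f v} = {c i} \<or> {v. 0 < f v} = {c i, c (Suc i)}"
      using f(2,3) by (subst (asm) L_eq) blast
    then have pos: "0 < f (c i)" by blast
    have zero: "f v = 0" if "v \<notin> {c i, c (Suc i)}" for v
      using that i(2) f(1)[of v] by (auto simp: less_le)
    have "?S f = (\<Sum>v\<in>{c i, c (Suc i)}. f v *\<^sub>R W v)"
      using finite_vertices[OF complex] simplex_subset_vertices[OF complex edge_in_L[OF i(1)]] zero
      by (intro sum.mono_neutral_right) auto
    also have "\<dots> = f (c i) *\<^sub>R W (c i) + f (c (Suc i)) *\<^sub>R W (c (Suc i))"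
      using c_Suc_neq[OF i(1)] by simp
    also have "\<dots> = of_real (f (c i) * cmod (W (c i))) * cis (?\<theta> i) +
        of_real (f (c (Suc i)) * cmod (W (c (Suc i)))) * cis (?\<theta> (Suc i))"
      by (subst (1) polar, use i in simp, subst (2) polar, use i in simp)
         (simp add: scaleR_conv_of_real mult.assoc)
    finally have S: "?S f = of_real (f (c i) * cmod (W (c i))) * cis (?\<theta> i) +
        of_real (f (c (Suc i)) * cmod (W (c (Suc i)))) * cis (?\<theta> (Suc i))" .
    have "0 < f (c i) * cmod (W (c i))" "0 \<le> f (c (Suc i)) * cmod (W (c (Suc i)))"
      using pos turn(3)[OF i(1)] f(1) by auto
    from Arg2pi_sector[OF this range(1) turn(1)[OF i(1)] range(2) turn(2)[OF i(1)]]
    show ?thesis unfolding S using i(1) pos by blast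
  qed
  show ?thesis
    unfolding fan_injective_def
  proof (intro allI impI)
    fix z :: "'v \<Rightarrow> real"
    assume P: "{v. 0 < z v} \<in> L" and N: "{v. z v < 0} \<in> L" and rel: "?S z = 0"
    define f g where "f = (\<lambda>v. max (z v) 0)" and "g = (\<lambda>v. max (- z v) 0)"
    have fz: "{v. 0 < f v} = {v. 0 < z v}" and gz: "{v. 0 < g v} = {v. z v < 0}"
      by (auto simp: f_def g_def less_max_iff_disj)
    have nonneg: "0 \<le> f v" "0 \<le> g v" for v by (auto simp: f_def g_def)
    have "f v - g v = z v" for v by (simp add: f_def g_def max_def)
    then have "?S f - ?S g = ?S z"
      by (simp flip: sum_subtractf scaleR_diff_left)
    then have eq: "?S f = ?S g" using rel by simp
    have empty: "?S h = 0" if "{v. 0 < h v} = {}" "\<And>v. 0 \<le> h v" for h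
    proof -
      have "h v = 0" for v using that(1) that(2)[of v] by (auto simp: less_le)
      then show ?thesis by simp
    qed
    show "z = (\<lambda>_. 0)"
    proof (rule ccontr)
      assume "z \<noteq> (\<lambda>_. 0)"
      then have "{v. 0 < f v} \<noteq> {} \<or> {v. 0 < g v} \<noteq> {}"
        unfolding fz gz by (auto simp: fun_eq_iff linorder_neq_iff)
      moreover have "{v. 0 < f v} \<noteq> {}" if "{v. 0 < g v} \<noteq> {}"
        using sector[of g] nonneg that N eq empty[of f] unfolding gz by auto
      moreover have "{v. 0 < g v} \<noteq> {}" if "{v. 0 < f v} \<noteq> {}"
        using sector[of f] nonneg that P eq empty[of g] unfolding fz by auto
      ultimately have ne: "{v. 0 < f v} \<noteq> {}" "{v. 0 < g v} \<noteq> {}" by blast+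
      obtain i where i: "i < m" "0 < f (c i)" "?\<theta> i \<le> Arg2pi (?S f)" "Arg2pi (?S f) < ?\<theta> (Suc i)"
        using sector[OF nonneg(1) _ ne(1)] P unfolding fz by blast
      obtain j where j: "j < m" "0 < g (c j)" "?\<theta> j \<le> Arg2pi (?S f)" "Arg2pi (?S f) < ?\<theta> (Suc j)"
        using sector[OF nonneg(2) _ ne(2)] N unfolding gz eq by blast
      have "i = j"
        using mono[of "Suc i" j] mono[of "Suc j" i] i j by (cases i j rule: linorder_cases) auto
      then show False using i(2) j(2) by (auto simp: f_def g_def less_max_iff_disj)
    qed
  qed
qed

end

lemma fan_injective_linear_inj_iff:
  assumes f: "linear f" "inj f"
  shows "fan_injective L (\<lambda>v. f (w v)) \<longleftrightarrow> fan_injective L w"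
proof -
  have "(\<Sum>v\<in>vertices L. z v *\<^sub>R f (w v)) = f (\<Sum>v\<in>vertices L. z v *\<^sub>R w v)" for z
    using f(1) by (simp add: linear_sum linear_scale)
  moreover have "f x = 0 \<longleftrightarrow> x = 0" for x
    using f by (metis injD linear_0)
  ultimately show ?thesis unfolding fan_injective_def by simp
qed

definition to_complex :: "real ^ 2 \<Rightarrow> complex" where
  "to_complex x = Complex (x $ 1) (x $ 2)"

definition of_complex :: "complex \<Rightarrow> real ^ 2" where
  "of_complex z = (\<chi> j. if j = 1 then Re z else Im z)"

lemma to_complex_inverse [simp]: "of_complex (to_complex x) = x"
  by (simp add: of_complex_def to_complex_def vec_eq_iff forall_2)

lemma of_complex_inverse [simp]: "to_complex (of_complex z) = z"
  by (simp add: of_complex_def to_complex_def)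

lemma linear_to_complex: "linear to_complex"
  by (rule linearI) (simp_all add: to_complex_def complex_eq_iff)

lemma inj_to_complex: "inj to_complex"
  by (metis inj_onI to_complex_inverse)

lemma to_complex_axis: "to_complex (axis 1 1) = 1" "to_complex (axis 2 1) = \<i>"
  by (simp_all add: to_complex_def axis_def complex_eq_iff)

lemma continuous_on_to_complex: "continuous_on S to_complex"
  using linear_to_complex by (rule linear_continuous_on[OF linear_conv_bounded_linear[THEN iffD1]])

lemma continuous_on_of_complex [continuous_intros]:
  "continuous_on S f \<Longrightarrow> continuous_on S (\<lambda>x. of_complex (f x))"
proof -
  assume f: "continuous_on S f"
  have "continuous_on S (\<lambda>x. if j = 1 then Re (f x) else Im (f x))" for j :: 2
    by (cases "j = 1") (auto intro!: continuous_intros f)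
  then show ?thesis unfolding of_complex_def by (intro continuous_on_vec_lambda)
qed

text \<open>
  The straight line in polar coordinates from \<open>z\<close> to the unit vector with argument \<open>a\<close>.
\<close>

definition polar_path :: "real \<Rightarrow> real \<Rightarrow> complex \<Rightarrow> complex" where
  "polar_path a t z = of_real ((1 - t) * cmod z + t) * cis ((1 - t) * Arg2pi z + t * a)"

lemma polar_path_0: "polar_path a 0 z = z"
  using complex_polar[of z] by (simp add: polar_path_def)

lemma polar_path_1: "polar_path a 1 z = cis a"
  by (simp add: polar_path_def)

lemma polar_path_fixed:
  assumes "cmod z = 1"
  shows "polar_path (Arg2pi z) t z = z"
proof -
  have "polar_path (Arg2pi z) t z = cis (Arg2pi z)"
    using assms by (simp add: polar_path_def algebra_simps)
  then show ?thesis using complex_polar[of z] assms by simp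
qed

text \<open>
  In polar coordinates the condition is convex: positive radii, and linear inequalities between
  arguments.
\<close>

lemma winds_once_polar_path:
  assumes Z: "winds_once m Z" and t: "0 \<le> t" "t \<le> 1"
    and T: "\<And>i. i < m \<Longrightarrow> 0 \<le> T i \<and> T i < 2 * pi" "T m = 2 * pi"
      "\<And>i. i < m \<Longrightarrow> T i < T (Suc i) \<and> T (Suc i) < T i + pi"
  shows "winds_once m (\<lambda>i. polar_path (T i) t (Z i))"
proof -
  have convex: "(1 - t) * x + t * y < (1 - t) * x' + t * y'" if "x < x'" "y < y'" for x x' y y' :: real
  proof (cases "t = 1")
    case False
    then show ?thesis
      using t that by (intro add_less_le_mono mult_strict_left_mono mult_left_mono) auto
  qed (use that in simp)
  have radius: "0 < (1 - t) * cmod (Z i) + t" if "i < m" for i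
  proof -
    have "0 < cmod (Z i)" using Z that by (simp add: winds_once_def)
    then show ?thesis using convex[of 0 "cmod (Z i)" 0 1] by simp
  qed
  have angle: "ray_angle m (\<lambda>i. polar_path (T i) t (Z i)) i = (1 - t) * ray_angle m Z i + t * T i"
    if "i \<le> m" for i
  proof (cases "i = m")
    case True
    then show ?thesis using T(2) by (simp add: ray_angle_def algebra_simps)
  next
    case False
    then have i: "i < m" using that by simp
    have "0 \<le> (1 - t) * Arg2pi (Z i) + t * T i"
      using t T(1)[OF i] Arg2pi[of "Z i"] by simp
    moreover have "(1 - t) * Arg2pi (Z i) + t * T i < 2 * pi"
      using convex[of "Arg2pi (Z i)" "2 * pi" "T i" "2 * pi"] T(1)[OF i] Arg2pi[of "Z i"]
      by (simp add: algebra_simps)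
    ultimately have "Arg2pi (polar_path (T i) t (Z i)) = (1 - t) * Arg2pi (Z i) + t * T i"
      unfolding polar_path_def by (rule Arg2pi_polar[OF radius[OF i]])
    then show ?thesis using False by (simp add: ray_angle_def)
  qed
  show ?thesis
    unfolding winds_once_def
  proof (intro allI impI)
    fix i assume i: "i < m"
    have Zi: "ray_angle m Z i < ray_angle m Z (Suc i)" "ray_angle m Z (Suc i) < ray_angle m Z i + pi"
      using Z i by (auto simp: winds_once_def)
    have "cmod (polar_path (T i) t (Z i)) = \<bar>(1 - t) * cmod (Z i) + t\<bar>"
      by (simp only: polar_path_def norm_mult norm_of_real norm_cis mult_1_right)
    then have "polar_path (T i) t (Z i) \<noteq> 0"
      using radius[OF i] by auto
    moreover have "(1 - t) * ray_angle m Z i + t * T i < (1 - t) * ray_angle m Z (Suc i) + t * T (Suc i)"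
      using convex Zi(1) T(3)[OF i] by blast
    moreover have "(1 - t) * ray_angle m Z (Suc i) + t * T (Suc i) < (1 - t) * ray_angle m Z i + t * T i + pi"
      using convex[OF Zi(2), of "T (Suc i)" "T i + pi"] T(3)[OF i] by (simp add: algebra_simps)
    ultimately show "polar_path (T i) t (Z i) \<noteq> 0 \<and>
        ray_angle m (\<lambda>i. polar_path (T i) t (Z i)) i < ray_angle m (\<lambda>i. polar_path (T i) t (Z i)) (Suc i) \<and>
        ray_angle m (\<lambda>i. polar_path (T i) t (Z i)) (Suc i) < ray_angle m (\<lambda>i. polar_path (T i) t (Z i)) i + pi"
      using i by (simp add: angle)
  qed
qed

text \<open>
  The alternative covers the two kinds of vertices of a cycle: the first vector is constantly \<open>1\<close>, and
  the others avoid the positive real axis.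
\<close>

lemma continuous_on_polar_path:
  assumes "(\<exists>z. S \<subseteq> {z}) \<or> S \<inter> \<real>\<^sub>\<ge>\<^sub>0 = {}"
  shows "continuous_on ({0..1} \<times> S) (\<lambda>(t, z). polar_path a t z)"
proof -
  have "continuous_on S Arg2pi"
    using assms
  proof
    assume "\<exists>z. S \<subseteq> {z}"
    then show ?thesis by (meson continuous_on_sing continuous_on_subset)
  next
    assume "S \<inter> \<real>\<^sub>\<ge>\<^sub>0 = {}"
    then show ?thesis
      by (intro continuous_at_imp_continuous_on ballI continuous_at_Arg2pi) auto
  qed
  then have "continuous_on ({0..1::real} \<times> S) (\<lambda>x. Arg2pi (snd x))"
    by (rule continuous_on_compose2) (auto intro: continuous_intros)
  then show ?thesis
    unfolding polar_path_def case_prod_unfold cis_conv_exp by (intro continuous_intros)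
qed

context cycle
begin

text \<open>
  The first two values are the arguments of the standard basis vectors, which must not move; the remaining
  angle of \<open>3 * pi / 2\<close> is divided evenly.
\<close>

definition target_angle :: "nat \<Rightarrow> real" where
  "target_angle i = (if i = 0 then 0 else pi / 2 + (real i - 1) * (3 * pi / (2 * (real m - 1))))"

lemma target_angle_bounds:
  shows "i < m \<Longrightarrow> 0 \<le> target_angle i \<and> target_angle i < 2 * pi"
    and "target_angle m = 2 * pi"
    and "i < m \<Longrightarrow> target_angle i < target_angle (Suc i) \<and> target_angle (Suc i) < target_angle i + pi"
proof -
  define g where "g = 3 * pi / (2 * (real m - 1))"
  have m': "2 \<le> real m - 1" using m by simp
  have g: "0 < g" "g < pi" "(real m - 1) * g = 3 * pi / 2"
    using m' pi_gt_zero by (auto simp: g_def divide_simps)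
  have T: "target_angle i = (if i = 0 then 0 else pi / 2 + (real i - 1) * g)" for i
    by (simp add: target_angle_def g_def)
  show last: "target_angle m = 2 * pi" using m g(3) by (simp add: T)
  show "target_angle i < target_angle (Suc i) \<and> target_angle (Suc i) < target_angle i + pi" for i
    using g(1,2) pi_gt_zero by (cases "i = 0") (auto simp: T algebra_simps)
  show "0 \<le> target_angle i \<and> target_angle i < 2 * pi" if "i < m"
  proof (cases "i = 0")
    case False
    have "(real i - 1) * g < (real m - 1) * g" using that g(1) by simp
    moreover have "0 \<le> (real i - 1) * g" using False g(1) by simp
    ultimately show ?thesis using False g(3) pi_gt_zero by (simp add: T)
  qed (simp add: T)
qed

text \<open>
  The first edge serves as the frame. Normalised flattenings are the configurations winding once around
  the origin, and these are contracted along straight lines in polar coordinates.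
\<close>

theorem flattening_space_cycle:
  "(flattening_space L :: ('v \<Rightarrow> real ^ 2) topology) homotopy_equivalent_space
     (orthogonal_group :: (real ^ 2 ^ 2) topology)"
proof -
  define \<beta> :: "2 \<Rightarrow> 'v" where "\<beta> = (\<lambda>j. if j = 1 then c 0 else c 1)"
  have \<beta>: "\<beta> 1 = c 0" "\<beta> 2 = c 1" by (auto simp: \<beta>_def)
  have inj\<beta>: "inj \<beta>"
    using c_eq_iff[of 0 1] m by (auto simp: inj_def forall_2 \<beta>)
  have "range \<beta> = {c 0, c (Suc 0)}" by (auto simp: UNIV_2 \<beta>)
  then have \<beta>L: "range \<beta> \<in> L" using edge_in_L[of 0] m by simp
  let ?Z = "\<lambda>(w::'v \<Rightarrow> real ^ 2) i. to_complex (w (c i))"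
  define N where "N = {w \<in> vertices L \<rightarrow>\<^sub>E UNIV. fan_injective L w \<and> (\<forall>j. w (\<beta> j) = (axis j 1 :: real ^ 2))}"
  have frame: "(\<forall>j. w (\<beta> j) = axis j 1) \<longleftrightarrow> ?Z w 0 = 1 \<and> ?Z w 1 = \<i>" for w
    unfolding forall_2 \<beta> using inj_to_complex to_complex_axis by (metis injD)
  have N: "w \<in> N \<longleftrightarrow> w \<in> vertices L \<rightarrow>\<^sub>E UNIV \<and> winds_once m (?Z w) \<and> ?Z w 0 = 1 \<and> ?Z w 1 = \<i>" for w
  proof -
    have "fan_injective L w \<longleftrightarrow> winds_once m (?Z w)" if "?Z w 0 = 1" "?Z w 1 = \<i>"
      using fan_injective_imp_winds_once[of "\<lambda>v. to_complex (w v)"]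
        winds_once_imp_fan_injective[of "\<lambda>v. to_complex (w v)"] that
        fan_injective_linear_inj_iff[OF linear_to_complex inj_to_complex, of L w] by auto
    then show ?thesis unfolding N_def frame by blast
  qed
  define T where "T = (\<lambda>v. target_angle (inv_into {..<m} c v))"
  have Tc: "T (c i) = target_angle i" if "i < m" for i
    using that inj by (simp add: T_def)
  have cV: "c i \<in> vertices L" if "i < m" for i using that by (simp add: vertices_eq)
  have Arg01: "Arg2pi 1 = 0" "Arg2pi \<i> = pi / 2"
    using Arg2pi_of_real[of 1] Arg2pi_polar[of 1 "pi / 2"] by simp_all
  have fixed: "polar_path 0 t 1 = 1" "polar_path (pi / 2) t \<i> = \<i>" for t
    using polar_path_fixed[of 1 t] polar_path_fixed[of \<i> t] unfolding Arg01 by simp_all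
  have winds_cong: "winds_once m Z \<longleftrightarrow> winds_once m Z'" if "\<And>i. i < m \<Longrightarrow> Z i = Z' i" for Z Z'
    using that by (auto simp: winds_once_def ray_angle_def)
  have in_N: "(\<lambda>v\<in>vertices L. of_complex (polar_path (T v) t (to_complex (w v)))) \<in> N"
    if w: "w \<in> N" and t: "0 \<le> t" "t \<le> 1" for w t
  proof -
    let ?w = "\<lambda>v\<in>vertices L. of_complex (polar_path (T v) t (to_complex (w v)))"
    have Z: "?Z ?w i = polar_path (target_angle i) t (?Z w i)" if "i < m" for i
      using that cV Tc by simp
    have "winds_once m (?Z ?w)"
      using winds_once_polar_path[OF _ t target_angle_bounds, of "?Z w"] w
      unfolding N by (subst winds_cong[OF Z]) auto
    moreover have "?Z ?w 0 = 1" "?Z ?w 1 = \<i>"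
      using w Z[of 0] Z[of 1] m fixed[of t]
      unfolding N by (simp_all add: target_angle_def)
    ultimately show ?thesis unfolding N by auto
  qed
  have "contractible_space (subtopology (product_topology (\<lambda>_. euclidean) (vertices L)) N)"
  proof (rule contractible_subset_of_product[where a = "\<lambda>v. of_complex (cis (T v))"
        and h = "\<lambda>v t x. of_complex (polar_path (T v) t (to_complex x))"])
    show "N \<subseteq> vertices L \<rightarrow>\<^sub>E UNIV" unfolding N_def by blast
    show "continuous_on ({0..1} \<times> (\<lambda>w. w v) ` N) (\<lambda>(t, x). of_complex (polar_path (T v) t (to_complex x)))"
      if v: "v \<in> vertices L" for v
    proof -
      obtain i where i: "i < m" "v = c i" using v by (auto simp: vertices_eq)
      let ?S = "(\<lambda>w. to_complex (w v)) ` N"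
      have "(\<exists>z. ?S \<subseteq> {z}) \<or> ?S \<inter> \<real>\<^sub>\<ge>\<^sub>0 = {}"
      proof (cases "i = 0")
        case True
        have "to_complex (w (c 0)) = 1" if "w \<in> N" for w using that unfolding N by blast
        then have "?S \<subseteq> {1}" unfolding i(2) True by auto
        then show ?thesis by blast
      next
        case False
        have "to_complex (w (c i)) \<notin> \<real>\<^sub>\<ge>\<^sub>0" if w: "w \<in> N" for w
        proof
          assume "to_complex (w (c i)) \<in> \<real>\<^sub>\<ge>\<^sub>0"
          then have "Arg2pi (?Z w i) = 0" by (auto simp: Arg2pi_eq_0 complex_nonneg_Reals_iff complex_is_Real_iff)
          moreover obtain k where k: "i = Suc k" using False not0_implies_Suc by blast
          moreover have "ray_angle m (?Z w) k < ray_angle m (?Z w) (Suc k)"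
            using w i(1) k unfolding N winds_once_def by simp
          ultimately show False
            using i(1) Arg2pi[of "?Z w k"] by (simp add: ray_angle_def)
        qed
        then show ?thesis unfolding i(2) by blast
      qed
      note polar = continuous_on_polar_path[OF this, of "T v"]
      have "continuous_on ({0..1} \<times> (\<lambda>w. w v) ` N) ((\<lambda>(t, z). polar_path (T v) t z) \<circ> (\<lambda>x. (fst x, to_complex (snd x))))"
      proof (rule continuous_on_compose)
        show "continuous_on ({0..1} \<times> (\<lambda>w. w v) ` N) (\<lambda>x. (fst x, to_complex (snd x)))"
          by (intro continuous_intros continuous_on_compose2[OF continuous_on_to_complex[of UNIV]]) auto
        show "continuous_on ((\<lambda>x. (fst x, to_complex (snd x))) ` ({0..1} \<times> (\<lambda>w. w v) ` N))
            (\<lambda>(t, z). polar_path (T v) t z)"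
          by (rule continuous_on_subset[OF polar]) auto
      qed
      then show ?thesis
        by (simp add: o_def case_prod_unfold continuous_on_of_complex)
    qed
  qed (use in_N in \<open>auto simp: polar_path_0 polar_path_1\<close>)
  moreover have "(\<lambda>v\<in>vertices L. of_complex (cis (T v))) \<in> N"
  proof -
    let ?w = "\<lambda>v\<in>vertices L. of_complex (cis (T v))"
    have Z: "?Z ?w i = cis (target_angle i)" if "i < m" for i
      using that cV Tc by simp
    have angle: "ray_angle m (\<lambda>i. cis (target_angle i)) i = target_angle i" if "i \<le> m" for i
      using that target_angle_bounds(1)[of i] target_angle_bounds(2) Arg2pi_polar[of 1 "target_angle i"]
      by (auto simp: ray_angle_def)
    have "winds_once m (?Z ?w)"
      by (subst winds_cong[OF Z]) (use target_angle_bounds(3) in \<open>auto simp: winds_once_def angle\<close>)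
    moreover have "?Z ?w 0 = 1" "?Z ?w 1 = \<i>"
      using Z[of 0] Z[of 1] m by (simp_all add: target_angle_def)
    ultimately show ?thesis unfolding N by auto
  qed
  ultimately show ?thesis
    unfolding N_def
    by (intro flattening_space_homotopy_equivalent_orthogonal_group[OF complex inj\<beta> \<beta>L]) auto
qed

end

section \<open>The homotopy types of the spaces of flattenings\<close>

theorem theorem17:
  shows "(\<forall>n::nat. CARD('d::finite) = n + 2 \<longrightarrow>
            (flattening_space (simplicial_join (simplex_boundary 1) (simplex_boundary (n + 1)))
               :: (nat + nat \<Rightarrow> real ^ 'd) topology)
            homotopy_equivalent_space (orthogonal_group :: (real ^ 'd ^ 'd) topology))
       \<and> (\<forall>L :: 'v set set. simplicial_sphere 1 L \<longrightarrow>
            (flattening_space L :: ('v \<Rightarrow> real ^ 2) topology)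
            homotopy_equivalent_space (orthogonal_group :: (real ^ 2 ^ 2) topology))"
proof (intro conjI allI impI)
  fix n :: nat assume "CARD('d) = n + 2"
  then show "(flattening_space (simplicial_join (simplex_boundary 1) (simplex_boundary (n + 1)))
       :: (nat + nat \<Rightarrow> real ^ 'd) topology)
      homotopy_equivalent_space (orthogonal_group :: (real ^ 'd ^ 'd) topology)"
    by (rule flattening_space_suspended_boundary)
next
  fix L :: "'v set set" assume L: "simplicial_sphere 1 L"
  obtain c m where "3 \<le> m" "inj_on c {..<m}" "c m = c (0::nat)" "vertices L = c ` {..<m}"
    "L = insert {} ((\<lambda>i. {c i}) ` {..<m} \<union> (\<lambda>i. {c i, c (Suc i)}) ` {..<m})"
    by (rule simplicial_circle_is_cycle[OF L])
  moreover have "finite_complex L" using L by (simp add: simplicial_sphere_def)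
  ultimately interpret cycle c m L by unfold_locales
  show "(flattening_space L :: ('v \<Rightarrow> real ^ 2) topology)
      homotopy_equivalent_space (orthogonal_group :: (real ^ 2 ^ 2) topology)"
    by (rule flattening_space_cycle)
qed

end
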